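(* Let $\mathcal{V}\subset\mathbb{R}^2$ be a finite set (sensor locations), $R_c>0$, and let $\mathcal{R}_{R_c}(\mathcal{V})$ be the Rips complex, whose underlying graph $G$ is assumed connected. Then HP transformations do not change the number of coverage holes in the Rips complex: if a complex is obtained from $\mathcal{R}_{R_c}(\mathcal{V})$ by any HP transformation (a finite sequence of deletions of vertices or edges, each of which is deletable in the current graph at the time it is deleted), then it has the same number of holes as $\mathcal{R}_{R_c}(\mathcal{V})$.
   Context: **Rips complex.** $\mathcal{R}_{R_c}(\mathcal{V})$ is the abstract simplicial complex whose $k$-simplices are the unordered $(k+1)$-tuples of distinct points of $\mathcal{V}$ that are pairwise within Euclidean distance $R_c$. Its underlying graph $G$ is its $1$-skeleton. **Number of holes.** The number of holes of such a complex is its first Betti number, i.e. the dimension of its first simplicial homology group with $\mathbb{Z}/2$ coefficients. **Deletion.** Deleting a simplex from the complex means removing that simplex together with all simplices containing it. After each deletion of a vertex or edge, $G$ denotes the $1$-skeleton of the resulting complex. **Cycles.** A cycle $C$ in a simple graph $G$ is a connected subgraph in which each vertex has degree two; its length is its number of edges. The sum of two cycles is the symmetric difference of their edge sets, $C_1\oplus C_2=(E(C_1)\cup E(C_2))\setminus(E(C_1)\cap E(C_2))$. The cycle space $C(G)$ contains all cycles of $G$, and $C_T(G)$ is the set of all cycles of length 3 in $G$. **Simple-connectedness graph.** A connected graph $G$ is of simple connectedness if it contains no cycle, or if for every cycle $C$ in $G$ there is a set $T_0\subseteq C_T(G)$ with $C=\sum_{T\in T_0}T$ (sum with respect to $\oplus$).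 **Neighbouring graphs.** $N_G(v)$ is the set of neighbours of $v$ in $G$ (not including $v$), and $G[X]$ is the subgraph induced by the vertex set $X$. The neighbouring graph of a vertex $v$ is $\Gamma_G(v)=G[N_G(v)]$. The neighbouring graph of an edge $e=[u,v]$ is $\Gamma_G(e)=G[(N_G(u)\cap N_G(v))\cup\{u,v\}]-e$, i.e. the induced subgraph with the edge $e$ removed. **HP (homology preserving) transformation.** A vertex or edge $x$ of $G$ is deletable if $\Gamma_G(x)$ (1) has two or more vertices, (2) is connected, and (3) is a simple-connectedness graph. An HP transformation is a sequential combination of deletions of vertices or edges, each deletable in the current graph. *)

theory Defs
  imports
    "HOL-Analysis.Analysis"
    "HOL-Library.Z2"
    "HOL-Algebra.AbelCoset"
    "Jordan_Normal_Form.Missing_VectorSpace"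
begin

section \<open>Simple graphs\<close>

record 'a graph =
  verts :: "'a set"
  edges :: "'a set set"

definition simple_graph :: "'a graph \<Rightarrow> bool" where
  "simple_graph G \<longleftrightarrow> finite (verts G) \<and> (\<forall>e\<in>edges G. e \<subseteq> verts G \<and> card e = 2)"

definition is_subgraph :: "'a graph \<Rightarrow> 'a graph \<Rightarrow> bool" where
  "is_subgraph H G \<longleftrightarrow> simple_graph H \<and> verts H \<subseteq> verts G \<and> edges H \<subseteq> edges G"

definition adjacent :: "'a graph \<Rightarrow> 'a \<Rightarrow> 'a \<Rightarrow> bool" where
  "adjacent G u v \<longleftrightarrow> {u, v} \<in> edges G"

text \<open>By this convention the graph without vertices is connected.\<close>

definition graph_connected :: "'a graph \<Rightarrow> bool" where
  "graph_connected G \<longleftrightarrow> (\<forall>u\<in>verts G. \<forall>v\<in>verts G. (adjacent G)\<^sup>*\<^sup>* u v)"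

definition neighbours :: "'a graph \<Rightarrow> 'a \<Rightarrow> 'a set" where
  "neighbours G v = {u. adjacent G v u}"

definition induced :: "'a graph \<Rightarrow> 'a set \<Rightarrow> 'a graph" where
  "induced G W = \<lparr>verts = verts G \<inter> W, edges = {e \<in> edges G. e \<subseteq> W}\<rparr>"

definition vertex_degree :: "'a graph \<Rightarrow> 'a \<Rightarrow> nat" where
  "vertex_degree G v = card {e \<in> edges G. v \<in> e}"


subsection \<open>Cycles and simple connectedness\<close>

definition is_cycle :: "'a graph \<Rightarrow> 'a graph \<Rightarrow> bool" where
  "is_cycle G C \<longleftrightarrow> is_subgraph C G \<and> verts C \<noteq> {} \<and> graph_connected C
     \<and> (\<forall>v\<in>verts C. vertex_degree C v = 2)"

definition triangles :: "'a graph \<Rightarrow> 'a graph set" where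
  "triangles G = {C. is_cycle G C \<and> card (edges C) = 3}"

definition edge_sum :: "'a set set \<Rightarrow> 'a set set \<Rightarrow> 'a set set" where
  "edge_sum A B = (A \<union> B) - (A \<inter> B)"

lemma comm_monoid_set_edge_sum: "comm_monoid_set edge_sum {}"
  by unfold_locales (auto simp: edge_sum_def)

text \<open>The sum of a finite family of cycles, as an edge set: the big operator of the
  commutative monoid of edge sets under \<^const>\<open>edge_sum\<close>.\<close>

definition cycle_sum :: "'a graph set \<Rightarrow> 'a set set" where
  "cycle_sum T = comm_monoid_set.F edge_sum {} edges T"

lemma cycle_sum_empty: "cycle_sum {} = {}"
  unfolding cycle_sum_def by (rule comm_monoid_set.empty[OF comm_monoid_set_edge_sum])

lemma cycle_sum_insert:
  assumes "finite T" "C \<notin> T"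
  shows "cycle_sum (insert C T) = edge_sum (edges C) (cycle_sum T)"
  unfolding cycle_sum_def by (rule comm_monoid_set.insert[OF comm_monoid_set_edge_sum assms])

definition simple_connectedness :: "'a graph \<Rightarrow> bool" where
  "simple_connectedness G \<longleftrightarrow> graph_connected G \<and>
     ((\<nexists>C. is_cycle G C) \<or>
      (\<forall>C. is_cycle G C \<longrightarrow> (\<exists>T\<subseteq>triangles G. edges C = cycle_sum T)))"


subsection \<open>Neighbouring graphs\<close>

definition vertex_nbr_graph :: "'a graph \<Rightarrow> 'a \<Rightarrow> 'a graph" where
  "vertex_nbr_graph G v = induced G (neighbours G v)"

definition edge_nbr_graph :: "'a graph \<Rightarrow> 'a \<Rightarrow> 'a \<Rightarrow> 'a graph" where
  "edge_nbr_graph G u v =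
     (let H = induced G ((neighbours G u \<inter> neighbours G v) \<union> {u, v})
      in H\<lparr>edges := edges H - {{u, v}}\<rparr>)"

definition deletable_nbr_graph :: "'a graph \<Rightarrow> bool" where
  "deletable_nbr_graph \<Gamma> \<longleftrightarrow>
     card (verts \<Gamma>) \<ge> 2 \<and> graph_connected \<Gamma> \<and> simple_connectedness \<Gamma>"


section \<open>Simplicial complexes\<close>

text \<open>An abstract simplicial complex is the set of its simplices, which are nonempty finite
  vertex sets; a \<open>k\<close>-simplex has \<open>k + 1\<close> vertices.\<close>

definition is_complex :: "'a set set \<Rightarrow> bool" where
  "is_complex K \<longleftrightarrow>
     (\<forall>\<sigma>\<in>K. finite \<sigma> \<and> \<sigma> \<noteq> {} \<and> (\<forall>\<tau>\<subseteq>\<sigma>. \<tau> \<noteq> {} \<longrightarrow> \<tau> \<in> K))"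

definition rips :: "'a::metric_space set \<Rightarrow> real \<Rightarrow> 'a set set" where
  "rips V R = {\<sigma>. \<sigma> \<noteq> {} \<and> finite \<sigma> \<and> \<sigma> \<subseteq> V \<and> pairwise (\<lambda>x y. dist x y \<le> R) \<sigma>}"

definition skeleton :: "'a set set \<Rightarrow> 'a graph" where
  "skeleton K = \<lparr>verts = {v. {v} \<in> K}, edges = {e \<in> K. card e = 2}\<rparr>"

definition delete_simplex :: "'a set \<Rightarrow> 'a set set \<Rightarrow> 'a set set" where
  "delete_simplex \<sigma> K = {\<tau> \<in> K. \<not> \<sigma> \<subseteq> \<tau>}"

inductive hp_step :: "'a set set \<Rightarrow> 'a set set \<Rightarrow> bool" where
  delete_vertex:
    "v \<in> verts (skeleton K) \<Longrightarrow> deletable_nbr_graph (vertex_nbr_graph (skeleton K) v)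
      \<Longrightarrow> hp_step K (delete_simplex {v} K)"
| delete_edge:
    "{u, v} \<in> edges (skeleton K) \<Longrightarrow> deletable_nbr_graph (edge_nbr_graph (skeleton K) u v)
      \<Longrightarrow> hp_step K (delete_simplex {u, v} K)"

definition hp_transformation :: "'a set set \<Rightarrow> 'a set set \<Rightarrow> bool" where
  "hp_transformation = hp_step\<^sup>*\<^sup>*"


lemma is_complex_rips: "is_complex (rips V R)"
  unfolding is_complex_def
proof (intro ballI conjI allI impI)
  fix \<sigma> \<tau> assume s: "\<sigma> \<in> rips V R"
  show "finite \<sigma>" "\<sigma> \<noteq> {}" using s unfolding rips_def by blast+
  assume t: "\<tau> \<subseteq> \<sigma>" "\<tau> \<noteq> {}"
  have "finite \<tau>" "\<tau> \<subseteq> V" using s t finite_subset unfolding rips_def by blast+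
  moreover have "pairwise (\<lambda>x y. dist x y \<le> R) \<tau>"
    using s t(1) pairwise_subset unfolding rips_def by blast
  ultimately show "\<tau> \<in> rips V R" using t(2) unfolding rips_def by blast
qed

lemma is_complex_delete_simplex:
  assumes "is_complex K"
  shows "is_complex (delete_simplex \<sigma> K)"
  using assms unfolding is_complex_def delete_simplex_def
  by (metis (no_types, lifting) mem_Collect_eq order_trans)

lemma is_complex_hp_transformation:
  assumes "hp_transformation K L" "is_complex K"
  shows "is_complex L"
proof -
  have "hp_step\<^sup>*\<^sup>* K L" using assms(1) by (simp add: hp_transformation_def)
  then show ?thesis
  proof induction
    case base
    show ?case by (rule assms(2))
  next
    case (step A B)
    from step.hyps(2) show ?case
      by cases (simp_all only: is_complex_delete_simplex[OF step.IH])
  qed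
qed


section \<open>Simplicial homology over the field with two elements\<close>

definition Z2_field :: "bit ring" where
  "Z2_field = \<lparr>carrier = UNIV, mult = (*), one = 1, zero = 0, add = (+)\<rparr>"

definition simplices :: "'a set set \<Rightarrow> nat \<Rightarrow> 'a set set" where
  "simplices K n = {\<sigma> \<in> K. card \<sigma> = n + 1}"

text \<open>A chain is the coefficient function of a formal linear combination of simplices. The
  fields \<^const>\<open>monoid.mult\<close> and \<^const>\<open>monoid.one\<close> of a module record carry no meaning.\<close>

definition chain_space :: "'a set set \<Rightarrow> nat \<Rightarrow> (bit, 'a set \<Rightarrow> bit) module" where
  "chain_space K n =
     \<lparr>carrier = {c. finite {\<sigma>. c \<sigma> \<noteq> 0} \<and> {\<sigma>. c \<sigma> \<noteq> 0} \<subseteq> simplices K n},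
      mult = undefined, one = undefined,
      zero = (\<lambda>\<sigma>. 0), add = (\<lambda>c d \<sigma>. c \<sigma> + d \<sigma>), smult = (\<lambda>a c \<sigma>. a * c \<sigma>)\<rparr>"

text \<open>The boundary of an \<open>n\<close>-chain is the linear extension of
  \<open>\<sigma> \<mapsto> (\<Sum>x\<in>\<sigma>. \<sigma> - {x})\<close>. The homology is not reduced, so it is zero for \<open>n = 0\<close>.\<close>

definition boundary :: "nat \<Rightarrow> ('a set \<Rightarrow> bit) \<Rightarrow> ('a set \<Rightarrow> bit)" where
  "boundary n c =
     (\<lambda>\<tau>. if n = 0 then 0
          else \<Sum>\<sigma> | c \<sigma> \<noteq> 0. c \<sigma> * (\<Sum>x\<in>\<sigma>. if \<tau> = \<sigma> - {x} then 1 else 0))"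

definition homology_cycles :: "'a set set \<Rightarrow> nat \<Rightarrow> ('a set \<Rightarrow> bit) set" where
  "homology_cycles K n = {c \<in> carrier (chain_space K n). boundary n c = (\<lambda>\<tau>. 0)}"

definition homology_boundaries :: "'a set set \<Rightarrow> nat \<Rightarrow> ('a set \<Rightarrow> bit) set" where
  "homology_boundaries K n = boundary (n + 1) ` carrier (chain_space K (n + 1))"

text \<open>The quotient of a module by a submodule. The image of a coset under multiplication by \<open>a\<close>
  need not be a full coset (take \<open>a = 0\<close>), hence the union of cosets.\<close>

definition quotient_module :: "('r, 'm) module \<Rightarrow> 'm set \<Rightarrow> ('r, 'm set) module" where
  "quotient_module M N =
     \<lparr>carrier = a_rcosets\<^bsub>M\<^esub> N, mult = undefined, one = undefined,
      zero = N, add = set_add M, smult = (\<lambda>a A. \<Union>x\<in>A. N +>\<^bsub>M\<^esub> (a \<odot>\<^bsub>M\<^esub> x))\<rparr>"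

definition simplicial_homology :: "'a set set \<Rightarrow> nat \<Rightarrow> (bit, ('a set \<Rightarrow> bit) set) module" where
  "simplicial_homology K n =
     quotient_module ((chain_space K n)\<lparr>carrier := homology_cycles K n\<rparr>)
       (homology_boundaries K n)"

definition betti :: "'a set set \<Rightarrow> nat \<Rightarrow> nat" where
  "betti K n = vectorspace.dim Z2_field (simplicial_homology K n)"

definition number_of_holes :: "'a set set \<Rightarrow> nat" where
  "number_of_holes K = betti K 1"


section \<open>The homology of a complex is a vector space\<close>

text \<open>The default simplification rules for \<^typ>\<open>bit\<close> replace the field operations by bit
  operations.\<close>

declare add_bit_eq_xor [simp del] mult_bit_eq_and [simp del]
  bit_not_zero_iff [simp del] bit_not_one_iff [simp del]

lemma bit_add_self: "(a::bit) + a = 0"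
  by (cases a) auto

lemma bit_add_self_left: "(a::bit) + (a + b) = b"
  by (simp add: add.assoc[symmetric] bit_add_self)

declare bit_add_self [simp] bit_add_self_left [simp]

lemma field_Z2: "field Z2_field"
proof -
  have "\<exists>y. x + y = 0" for x :: bit
    using add.right_inverse by blast
  moreover have "x \<noteq> 0 \<Longrightarrow> \<exists>y. x * y = 1" for x :: bit
    by (rule exI[of _ 1], cases x) auto
  ultimately show ?thesis
    unfolding Z2_field_def using add.right_inverse
    by unfold_locales (auto simp:algebra_simps Units_def)
qed

lemma chain_space_module: "module Z2_field (chain_space K n)"
proof -
  have fin: "finite {\<sigma>. c \<sigma> + d \<sigma> \<noteq> 0}" if "finite {\<sigma>. c \<sigma> \<noteq> 0}" "finite {\<sigma>. d \<sigma> \<noteq> 0}" for c d :: "'a set \<Rightarrow> bit"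
    by (rule finite_subset[OF _ finite_UnI[OF that]]) auto
  have ag: "abelian_group (chain_space K n)"
  proof (rule abelian_groupI)
    fix x y assume "x \<in> carrier (chain_space K n)" "y \<in> carrier (chain_space K n)"
    then show "x \<oplus>\<^bsub>chain_space K n\<^esub> y \<in> carrier (chain_space K n)"
      using fin[of x y] by (simp add: chain_space_def subset_iff) (metis add_0)
  next
    fix x assume "x \<in> carrier (chain_space K n)"
    then show "\<exists>y\<in>carrier (chain_space K n). y \<oplus>\<^bsub>chain_space K n\<^esub> x = \<zero>\<^bsub>chain_space K n\<^esub>"
      by (intro bexI[of _ x]) (auto simp: chain_space_def)
  qed (auto simp: chain_space_def algebra_simps)
  show ?thesis
  proof (rule moduleI[OF _ ag])
    show "cring Z2_field" using field_Z2 by (simp add: field_def domain_def)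
    fix a x assume "x \<in> carrier (chain_space K n)"
    then show "a \<odot>\<^bsub>chain_space K n\<^esub> x \<in> carrier (chain_space K n)"
      by (cases a) (auto simp: chain_space_def)
  qed (auto simp: chain_space_def Z2_field_def algebra_simps)
qed

lemma quotient_module_module:
  assumes "module R M" "submodule R N M"
  shows "module R (quotient_module M N)"
proof -
  interpret module R M by fact
  interpret S: submodule R N M by fact
  interpret A: abelian_subgroup N M
  proof (rule abelian_subgroupI3)
    show "additive_subgroup N M"
    proof (rule additive_subgroupI, rule add.subgroupI)
      show "\<ominus>\<^bsub>M\<^esub> x \<in> N" if "x \<in> N" for x
        using that S.subset S.smult_closed[of "\<ominus>\<^bsub>R\<^esub> \<one>\<^bsub>R\<^esub>" x] smult_minus_1[of x]
        by (auto simp: subset_iff)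
    qed (use S.subset S.zero_closed in \<open>auto simp del: S.zero_closed\<close>)
  qed (rule abelian_group_axioms)
  have sm: "(\<Union>x\<in>N +>\<^bsub>M\<^esub> y. N +>\<^bsub>M\<^esub> (a \<odot>\<^bsub>M\<^esub> x)) = N +>\<^bsub>M\<^esub> (a \<odot>\<^bsub>M\<^esub> y)"
    if "y \<in> carrier M" "a \<in> carrier R" for y a
  proof -
    have "N +>\<^bsub>M\<^esub> (a \<odot>\<^bsub>M\<^esub> x) = N +>\<^bsub>M\<^esub> (a \<odot>\<^bsub>M\<^esub> y)" if x: "x \<in> N +>\<^bsub>M\<^esub> y" for x
    proof -
      obtain h where h: "h \<in> N" "x = h \<oplus>\<^bsub>M\<^esub> y" using x by (auto simp: a_r_coset_def')
      have hM: "h \<in> carrier M" using h(1) A.a_subset by auto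
      have "a \<odot>\<^bsub>M\<^esub> x = a \<odot>\<^bsub>M\<^esub> h \<oplus>\<^bsub>M\<^esub> a \<odot>\<^bsub>M\<^esub> y"
        using h hM \<open>y \<in> carrier M\<close> \<open>a \<in> carrier R\<close> by (simp add: smult_r_distr)
      then have "a \<odot>\<^bsub>M\<^esub> x \<in> N +>\<^bsub>M\<^esub> (a \<odot>\<^bsub>M\<^esub> y)"
        using h(1) \<open>a \<in> carrier R\<close> by (auto simp: a_r_coset_def')
      then show ?thesis
        using A.a_repr_independence'[of "a \<odot>\<^bsub>M\<^esub> x" "a \<odot>\<^bsub>M\<^esub> y"] \<open>y \<in> carrier M\<close> \<open>a \<in> carrier R\<close> by simp
    qed
    moreover have "y \<in> N +>\<^bsub>M\<^esub> y" using A.a_rcos_self that by blast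
    ultimately show ?thesis by blast
  qed
  have cos: "\<And>A. A \<in> a_rcosets\<^bsub>M\<^esub> N \<longleftrightarrow> (\<exists>y\<in>carrier M. A = N +>\<^bsub>M\<^esub> y)"
    by (auto simp: A_RCOSETS_def RCOSETS_def a_r_coset_def)
  have cosI: "\<And>y. y \<in> carrier M \<Longrightarrow> N +>\<^bsub>M\<^esub> y \<in> a_rcosets\<^bsub>M\<^esub> N" using cos by blast
  interpret Q: comm_group "M A_Mod N" by (rule A.a_factorgroup_is_comm_group)
  have r: "carrier (quotient_module M N) = carrier (M A_Mod N)"
    "add (quotient_module M N) = mult (M A_Mod N)" "zero (quotient_module M N) = one (M A_Mod N)"
    by (simp_all add: quotient_module_def A_FactGroup_def FactGroup_def A_RCOSETS_def set_add_def)
  have ag: "abelian_group (quotient_module M N)"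
    by (rule abelian_groupI; unfold r) (rule Q.m_closed Q.one_closed Q.m_assoc Q.m_comm Q.l_one Q.l_inv_ex; assumption)+
  let ?Q = "quotient_module M N"
  have smQ: "a \<odot>\<^bsub>?Q\<^esub> (N +>\<^bsub>M\<^esub> y) = N +>\<^bsub>M\<^esub> (a \<odot>\<^bsub>M\<^esub> y)"
    if "y \<in> carrier M" "a \<in> carrier R" for a y
    using sm[OF that] by (simp only: quotient_module_def module.simps)
  have addQ: "(N +>\<^bsub>M\<^esub> x) \<oplus>\<^bsub>?Q\<^esub> (N +>\<^bsub>M\<^esub> y) = N +>\<^bsub>M\<^esub> (x \<oplus>\<^bsub>M\<^esub> y)"
    if "x \<in> carrier M" "y \<in> carrier M" for x y
    using A.a_rcos_sum[OF that] by (simp add: quotient_module_def)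
  have cQ: "x \<in> carrier ?Q \<longleftrightarrow> (\<exists>y\<in>carrier M. x = N +>\<^bsub>M\<^esub> y)" for x
    by (simp add: quotient_module_def cos)
  show ?thesis
  proof (rule moduleI[OF _ ag])
    show "cring R" by (rule R.cring_axioms)
    show "a \<odot>\<^bsub>?Q\<^esub> x \<in> carrier ?Q" if "a \<in> carrier R" "x \<in> carrier ?Q" for a x
      using that smQ unfolding cQ by blast
    show "\<one>\<^bsub>R\<^esub> \<odot>\<^bsub>?Q\<^esub> x = x" if "x \<in> carrier ?Q" for x
      using that by (auto simp: cQ smQ simp del: UN_simps)
    fix a b x assume ab: "a \<in> carrier R" "b \<in> carrier R" "x \<in> carrier ?Q"
    then obtain u where u: "u \<in> carrier M" "x = N +>\<^bsub>M\<^esub> u" by (auto simp: cQ)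
    show "(a \<oplus>\<^bsub>R\<^esub> b) \<odot>\<^bsub>?Q\<^esub> x = a \<odot>\<^bsub>?Q\<^esub> x \<oplus>\<^bsub>?Q\<^esub> b \<odot>\<^bsub>?Q\<^esub> x"
      using ab u by (simp add: smQ addQ smult_l_distr)
    show "(a \<otimes>\<^bsub>R\<^esub> b) \<odot>\<^bsub>?Q\<^esub> x = a \<odot>\<^bsub>?Q\<^esub> (b \<odot>\<^bsub>?Q\<^esub> x)"
      using ab u by (simp add: smQ smult_assoc1)
    fix y assume "y \<in> carrier ?Q"
    then obtain v where v: "v \<in> carrier M" "y = N +>\<^bsub>M\<^esub> v" by (auto simp: cQ)
    show "a \<odot>\<^bsub>?Q\<^esub> (x \<oplus>\<^bsub>?Q\<^esub> y) = a \<odot>\<^bsub>?Q\<^esub> x \<oplus>\<^bsub>?Q\<^esub> a \<odot>\<^bsub>?Q\<^esub> y"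
      using ab u v by (simp add: smQ addQ smult_r_distr)
  qed
qed

lemma boundary_superset:
  assumes "finite F" "{\<sigma>. c \<sigma> \<noteq> 0} \<subseteq> F" "n \<noteq> 0"
  shows "boundary n c \<tau> = (\<Sum>\<sigma>\<in>F. c \<sigma> * (\<Sum>x\<in>\<sigma>. if \<tau> = \<sigma> - {x} then 1 else 0))"
  using assms unfolding boundary_def by (auto intro!: sum.mono_neutral_left)

lemma boundary_add:
  assumes "finite {\<sigma>. c \<sigma> \<noteq> 0}" "finite {\<sigma>. d \<sigma> \<noteq> 0}"
  shows "boundary n (\<lambda>\<sigma>. c \<sigma> + d \<sigma>) = (\<lambda>\<tau>. boundary n c \<tau> + boundary n d \<tau>)"
proof (cases "n = 0")
  case False
  have f: "finite ({\<sigma>. c \<sigma> \<noteq> 0} \<union> {\<sigma>. d \<sigma> \<noteq> 0})" using assms by blast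
  show ?thesis
    by (rule ext, subst (1 2 3) boundary_superset[OF f])
       (use False in \<open>auto simp: sum.distrib distrib_right\<close>)
qed (simp add: boundary_def)

lemma sym_sum_zero:
  fixes f :: "'a \<Rightarrow> 'a \<Rightarrow> bit"
  assumes "finite A" "\<And>x y. f x y = f y x"
  shows "(\<Sum>x\<in>A. \<Sum>y\<in>A-{x}. f x y) = 0"
  using assms(1)
proof induction
  case (insert a A)
  have "(\<Sum>y\<in>insert a A-{x}. f x y) = f x a + (\<Sum>y\<in>A-{x}. f x y)" if "x \<in> A" for x
  proof -
    have "insert a A - {x} = insert a (A - {x})" using insert that by auto
    then show ?thesis using insert by simp
  qed
  moreover have "insert a A - {a} = A" using insert by auto
  ultimately show ?case using insert
    by (simp add: sum.distrib assms(2)[of _ a])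
qed simp

lemma boundary_support:
  "{\<rho>. boundary n c \<rho> \<noteq> 0} \<subseteq> (\<Union>\<sigma>\<in>{\<sigma>. c \<sigma> \<noteq> 0}. (\<lambda>x. \<sigma> - {x}) ` \<sigma>)"
proof
  fix \<rho> assume "\<rho> \<in> {\<rho>. boundary n c \<rho> \<noteq> 0}"
  then have "(\<Sum>\<sigma> | c \<sigma> \<noteq> 0. c \<sigma> * (\<Sum>x\<in>\<sigma>. if \<rho> = \<sigma> - {x} then 1 else 0)) \<noteq> 0"
    by (auto simp: boundary_def split: if_splits)
  then obtain \<sigma> where s: "\<sigma> \<in> {\<sigma>. c \<sigma> \<noteq> 0}"
    "c \<sigma> * (\<Sum>x\<in>\<sigma>. if \<rho> = \<sigma> - {x} then 1 else 0) \<noteq> 0"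
    by (rule sum.not_neutral_contains_not_neutral)
  from s(2) have "(\<Sum>x\<in>\<sigma>. if \<rho> = \<sigma> - {x} then 1 else 0 :: bit) \<noteq> 0" by auto
  then obtain x where "x \<in> \<sigma>" "(if \<rho> = \<sigma> - {x} then 1 else 0 :: bit) \<noteq> 0"
    by (rule sum.not_neutral_contains_not_neutral)
  then have "x \<in> \<sigma>" "\<rho> = \<sigma> - {x}" by (auto split: if_splits)
  with s(1) show "\<rho> \<in> (\<Union>\<sigma>\<in>{\<sigma>. c \<sigma> \<noteq> 0}. (\<lambda>x. \<sigma> - {x}) ` \<sigma>)" by blast
qed

lemma boundary_boundary:
  assumes "\<And>\<sigma>. c \<sigma> \<noteq> 0 \<Longrightarrow> finite \<sigma>" "finite {\<sigma>. c \<sigma> \<noteq> 0}"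
  shows "boundary n (boundary (n+1) c) = (\<lambda>_. 0)"
proof (cases "n = 0")
  case False
  define S where "S = {\<sigma>. c \<sigma> \<noteq> 0}"
  define F where "F = (\<Union>\<sigma>\<in>S. (\<lambda>x. \<sigma> - {x}) ` \<sigma>)"
  have fS: "finite S" and fs: "\<And>\<sigma>. \<sigma> \<in> S \<Longrightarrow> finite \<sigma>" using assms by (auto simp: S_def)
  have fF: "finite F" unfolding F_def using fS fs by auto
  have b: "boundary (n+1) c \<rho> = (\<Sum>\<sigma>\<in>S. c \<sigma> * (\<Sum>x\<in>\<sigma>. if \<rho> = \<sigma> - {x} then 1 else 0))" for \<rho>
    by (rule boundary_superset[OF fS]) (auto simp: S_def)
  have sub: "{\<rho>. boundary (n+1) c \<rho> \<noteq> 0} \<subseteq> F"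
    unfolding F_def S_def by (rule boundary_support)
  show ?thesis
  proof
    fix \<tau>
    define g :: "'a set \<Rightarrow> bit" where "g \<rho> = (\<Sum>y\<in>\<rho>. if \<tau> = \<rho> - {y} then 1 else 0)" for \<rho>
    have in0: "(\<Sum>x\<in>\<sigma>. g (\<sigma> - {x})) = 0" if "\<sigma> \<in> S" for \<sigma>
      unfolding g_def
      by (rule sym_sum_zero[OF fs[OF that]]) (auto simp: Diff_insert2[symmetric] insert_commute)
    have "boundary n (boundary (n+1) c) \<tau> = (\<Sum>\<rho>\<in>F. boundary (n+1) c \<rho> * g \<rho>)"
      unfolding g_def by (rule boundary_superset[OF fF sub False])
    also have "\<dots> = (\<Sum>\<rho>\<in>F. \<Sum>\<sigma>\<in>S. c \<sigma> * (\<Sum>x\<in>\<sigma>. (if \<rho> = \<sigma> - {x} then g \<rho> else 0)))"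
      unfolding b by (auto simp: sum_distrib_right sum_distrib_left intro!: sum.cong)
    also have "\<dots> = (\<Sum>\<sigma>\<in>S. \<Sum>\<rho>\<in>F. c \<sigma> * (\<Sum>x\<in>\<sigma>. (if \<rho> = \<sigma> - {x} then g \<rho> else 0)))"
      by (rule sum.swap)
    also have "\<dots> = (\<Sum>\<sigma>\<in>S. c \<sigma> * (\<Sum>x\<in>\<sigma>. \<Sum>\<rho>\<in>F. (if \<rho> = \<sigma> - {x} then g \<rho> else 0)))"
      by (rule sum.cong) (auto simp: sum_distrib_left[symmetric] intro: sum.swap)
    also have "\<dots> = (\<Sum>\<sigma>\<in>S. c \<sigma> * (\<Sum>x\<in>\<sigma>. g (\<sigma> - {x})))"
    proof (intro sum.cong refl arg_cong2[where f="(*)"])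
      fix \<sigma> x assume "\<sigma> \<in> S" "x \<in> \<sigma>"
      then have "\<sigma> - {x} \<in> F" unfolding F_def by blast
      then show "(\<Sum>\<rho>\<in>F. (if \<rho> = \<sigma> - {x} then g \<rho> else 0)) = g (\<sigma> - {x})"
        by (simp add: sum.delta[OF fF])
    qed
    also have "\<dots> = 0" by (simp add: in0)
    finally show "boundary n (boundary (n+1) c) \<tau> = 0" .
  qed
qed (simp add: boundary_def)

lemma boundary_closed:
  assumes "is_complex K" "c \<in> carrier (chain_space K (n+1))"
  shows "boundary (n+1) c \<in> carrier (chain_space K n)"
proof -
  define S where "S = {\<sigma>. c \<sigma> \<noteq> 0}"
  define F where "F = (\<Union>\<sigma>\<in>S. (\<lambda>x. \<sigma> - {x}) ` \<sigma>)"
  have SK: "S \<subseteq> simplices K (n+1)" and fS: "finite S"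
    using assms by (auto simp: S_def chain_space_def)
  have fs: "\<And>\<sigma>. \<sigma> \<in> S \<Longrightarrow> finite \<sigma>" using SK assms(1) by (auto simp: simplices_def is_complex_def)
  have fF: "finite F" unfolding F_def using fS fs by auto
  have b: "boundary (n+1) c \<rho> = (\<Sum>\<sigma>\<in>S. c \<sigma> * (\<Sum>x\<in>\<sigma>. if \<rho> = \<sigma> - {x} then 1 else 0))" for \<rho>
    by (rule boundary_superset[OF fS]) (auto simp: S_def)
  have sub: "{\<rho>. boundary (n+1) c \<rho> \<noteq> 0} \<subseteq> F"
    unfolding F_def S_def by (rule boundary_support)
  have "F \<subseteq> simplices K n"
  proof
    fix \<rho> assume "\<rho> \<in> F"
    then obtain \<sigma> x where s: "\<sigma> \<in> K" "card \<sigma> = n + 2" "x \<in> \<sigma>" "\<rho> = \<sigma> - {x}"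
      using SK by (auto simp: F_def simplices_def)
    then have "card \<rho> = n + 1" by simp
    moreover then have "\<rho> \<noteq> {}" by auto
    ultimately show "\<rho> \<in> simplices K n" using s assms(1) by (auto simp: simplices_def is_complex_def)
  qed
  then show ?thesis using subset_trans[OF sub] finite_subset[OF sub fF]
    by (simp add: chain_space_def)
qed

lemma boundary_zero: "boundary n (\<lambda>_. 0) = (\<lambda>_. 0)" by (auto simp: boundary_def)

lemma homology_vectorspace:
  assumes K: "is_complex K"
  shows "vectorspace Z2_field (simplicial_homology K n)"
proof -
  have cfin: "\<And>m c. c \<in> carrier (chain_space K m) \<Longrightarrow> finite {\<sigma>. c \<sigma> \<noteq> 0}"
    by (auto simp: chain_space_def)
  have cyc: "submodule Z2_field (homology_cycles K n) (chain_space K n)"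
  proof (rule submodule.intro[OF chain_space_module])
    fix v w assume vw: "v \<in> homology_cycles K n" "w \<in> homology_cycles K n"
    interpret module Z2_field "chain_space K n" by (rule chain_space_module)
    have c: "v \<in> carrier (chain_space K n)" "w \<in> carrier (chain_space K n)"
      using vw by (auto simp: homology_cycles_def)
    have "v \<oplus>\<^bsub>chain_space K n\<^esub> w = (\<lambda>\<sigma>. v \<sigma> + w \<sigma>)" by (simp add: chain_space_def)
    then show "v \<oplus>\<^bsub>chain_space K n\<^esub> w \<in> homology_cycles K n"
      using vw c M.add.m_closed[OF c] boundary_add[OF cfin[OF c(1)] cfin[OF c(2)]]
      by (simp add: homology_cycles_def)
  next
    fix a v assume v: "v \<in> homology_cycles K n"
    then show "a \<odot>\<^bsub>chain_space K n\<^esub> v \<in> homology_cycles K n"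
      by (cases a) (auto simp: homology_cycles_def chain_space_def boundary_zero)
  qed (auto simp: homology_cycles_def chain_space_def boundary_zero)
  interpret C: module Z2_field "chain_space K n" by (rule chain_space_module)
  let ?Z = "(chain_space K n)\<lparr>carrier := homology_cycles K n\<rparr>"
  have mZ: "module Z2_field ?Z" by (rule C.submodule_is_module[OF cyc])
  have sub: "homology_boundaries K n \<subseteq> homology_cycles K n"
  proof -
    have "boundary (n+1) c \<in> homology_cycles K n" if c: "c \<in> carrier (chain_space K (n+1))" for c
    proof -
      have "finite \<sigma>" if "c \<sigma> \<noteq> 0" for \<sigma>
      proof -
        have "\<sigma> \<in> K" using c that by (auto simp: chain_space_def simplices_def)
        then show ?thesis using K by (simp add: is_complex_def)
      qed
      then show ?thesis
        unfolding homology_cycles_def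
        using boundary_closed[OF K c] boundary_boundary[OF _ cfin[OF c]] by blast
    qed
    then show ?thesis unfolding homology_boundaries_def by blast
  qed
  have bd: "submodule Z2_field (homology_boundaries K n) ?Z"
  proof (rule submodule.intro[OF mZ])
    fix v w assume "v \<in> homology_boundaries K n" "w \<in> homology_boundaries K n"
    then obtain c d where c: "c \<in> carrier (chain_space K (n+1))" "v = boundary (n+1) c"
      and d: "d \<in> carrier (chain_space K (n+1))" "w = boundary (n+1) d"
      by (auto simp: homology_boundaries_def)
    interpret module Z2_field "chain_space K (n+1)" by (rule chain_space_module)
    have "(\<lambda>\<sigma>. c \<sigma> + d \<sigma>) \<in> carrier (chain_space K (n+1))"
      using M.add.m_closed[OF c(1) d(1)] by (simp add: chain_space_def)
    moreover have "v \<oplus>\<^bsub>?Z\<^esub> w = boundary (n+1) (\<lambda>\<sigma>. c \<sigma> + d \<sigma>)"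
      using boundary_add[OF cfin[OF c(1)] cfin[OF d(1)]] c d by (simp add: chain_space_def)
    ultimately show "v \<oplus>\<^bsub>?Z\<^esub> w \<in> homology_boundaries K n"
      unfolding homology_boundaries_def by blast
  next
    have z: "(\<lambda>_. 0) \<in> homology_boundaries K n"
      unfolding homology_boundaries_def
      by (rule image_eqI[where x="\<lambda>_. 0"]) (auto simp: boundary_zero chain_space_def)
    then show "\<zero>\<^bsub>?Z\<^esub> \<in> homology_boundaries K n" by (simp add: chain_space_def)
    fix a v assume v: "v \<in> homology_boundaries K n"
    then show "a \<odot>\<^bsub>?Z\<^esub> v \<in> homology_boundaries K n"
      using z by (cases a) (auto simp: chain_space_def)
  qed (use sub in auto)
  show ?thesis
    unfolding simplicial_homology_def vectorspace_def
    using quotient_module_module[OF mZ bd] field_Z2 by blast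
qed

end

theory Submission
  imports Defs
begin

text \<open>Every complex reached from a Rips complex is a flag complex, so it is determined by its
  underlying graph. Deleting a simplex \<open>\<sigma>\<close> removes its open star; the closed star is a cone and
  meets the remaining complex in a flag complex, the rim of \<open>\<sigma>\<close>, whose \<open>1\<close>-skeleton is the
  neighbouring graph of \<open>\<sigma>\<close>. Connectedness of this graph says that the rim has trivial reduced
  \<open>H\<^sub>0\<close>. As every cycle of the graph is a sum of triangles and every edge set with even degrees
  is a sum of cycles, the rim has trivial \<open>H\<^sub>1\<close> too. As in the Mayer-Vietoris sequence, the
  inclusion of the remaining complex then induces an isomorphism on \<open>H\<^sub>1\<close>.\<close>

section \<open>Homology classes\<close>

text \<open>Simple connectedness constrains only graph cycles, that is, connected subgraphs with all
  degrees two, whereas homology deals with arbitrary edge sets of even degrees; closing this gap is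
  the combinatorial core. Coefficients in Z/2 make the translation literal: a chain is its support,
  and the symmetric difference of edge sets is chain addition.

  The rim is the join of the boundary of \<open>\<sigma>\<close> with its link: the link itself for
  a vertex, the suspension of the link for an edge. This is why the neighbouring graph of an edge
  keeps \<open>u\<close> and \<open>v\<close> but not the edge between them.

  No exact sequence is built. A chain is cut into the simplices containing \<open>\<sigma>\<close>
  and the rest, and the boundary of the first piece is filled in the rim.\<close>

abbreviation add_chain :: "('a set \<Rightarrow> bit) \<Rightarrow> ('a set \<Rightarrow> bit) \<Rightarrow> 'a set \<Rightarrow> bit" (infixl "\<oplus>\<^sub>c" 65) where
  "c \<oplus>\<^sub>c d \<equiv> (\<lambda>\<sigma>. c \<sigma> + d \<sigma>)"

abbreviation zero_chain :: "'a set \<Rightarrow> bit" ("\<zero>\<^sub>c") where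
  "\<zero>\<^sub>c \<equiv> (\<lambda>\<sigma>. 0)"

text \<open>Cosets are formed for arbitrary chains, not only for cycles, which keeps the membership
  and equality criteria free of side conditions.\<close>

definition homology_class :: "'a set set \<Rightarrow> nat \<Rightarrow> ('a set \<Rightarrow> bit) \<Rightarrow> ('a set \<Rightarrow> bit) set" where
  "homology_class K n z = (\<lambda>b. b \<oplus>\<^sub>c z) ` homology_boundaries K n"

lemma chain_space_iff:
  "c \<in> carrier (chain_space K n) \<longleftrightarrow> finite {\<sigma>. c \<sigma> \<noteq> 0} \<and> {\<sigma>. c \<sigma> \<noteq> 0} \<subseteq> simplices K n"
  by (simp add: chain_space_def)

lemma chain_space_finite_support: "c \<in> carrier (chain_space K n) \<Longrightarrow> finite {\<sigma>. c \<sigma> \<noteq> 0}"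
  by (simp add: chain_space_iff)

lemma chain_space_add:
  assumes "c \<in> carrier (chain_space K n)" "d \<in> carrier (chain_space K n)"
  shows "c \<oplus>\<^sub>c d \<in> carrier (chain_space K n)"
proof -
  have "{\<sigma>. c \<sigma> + d \<sigma> \<noteq> 0} \<subseteq> {\<sigma>. c \<sigma> \<noteq> 0} \<union> {\<sigma>. d \<sigma> \<noteq> 0}" by auto
  then show ?thesis
    using assms unfolding chain_space_iff by (metis (no_types, lifting) Un_least finite_UnI finite_subset order_trans)
qed

lemma chain_space_zero: "\<zero>\<^sub>c \<in> carrier (chain_space K n)"
  by (simp add: chain_space_iff)

lemma chain_space_mono: "K \<subseteq> L \<Longrightarrow> carrier (chain_space K n) \<subseteq> carrier (chain_space L n)"
  by (fastforce simp: chain_space_iff simplices_def)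

lemma boundary_add_chain:
  assumes "c \<in> carrier (chain_space K n)" "d \<in> carrier (chain_space L n)"
  shows "boundary m (c \<oplus>\<^sub>c d) = boundary m c \<oplus>\<^sub>c boundary m d"
  by (rule boundary_add[OF chain_space_finite_support chain_space_finite_support]) fact+

lemma homology_boundaries_add:
  assumes "b \<in> homology_boundaries K n" "c \<in> homology_boundaries K n"
  shows "b \<oplus>\<^sub>c c \<in> homology_boundaries K n"
proof -
  obtain b' c' where b: "b' \<in> carrier (chain_space K (n+1))" "b = boundary (n+1) b'"
    and c: "c' \<in> carrier (chain_space K (n+1))" "c = boundary (n+1) c'"
    using assms by (auto simp: homology_boundaries_def)
  have "b \<oplus>\<^sub>c c = boundary (n+1) (b' \<oplus>\<^sub>c c')"
    using boundary_add_chain[OF b(1) c(1)] b c by simp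
  then show ?thesis
    using chain_space_add[OF b(1) c(1)] unfolding homology_boundaries_def by blast
qed

lemma homology_boundaries_zero: "\<zero>\<^sub>c \<in> homology_boundaries K n"
  unfolding homology_boundaries_def
  by (rule image_eqI[where x = "\<zero>\<^sub>c"]) (simp_all add: boundary_zero chain_space_zero)

lemma homology_boundaries_mono: "K \<subseteq> L \<Longrightarrow> homology_boundaries K n \<subseteq> homology_boundaries L n"
  unfolding homology_boundaries_def by (rule image_mono) (rule chain_space_mono)

lemma homology_cycles_add:
  assumes "z \<in> homology_cycles K n" "w \<in> homology_cycles K n"
  shows "z \<oplus>\<^sub>c w \<in> homology_cycles K n"
  using assms boundary_add_chain[of z K n w K n] chain_space_add[of z K n w]
  by (auto simp: homology_cycles_def)

lemma homology_cycles_mono: "K \<subseteq> L \<Longrightarrow> homology_cycles K n \<subseteq> homology_cycles L n"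
  using chain_space_mono[of K L n] by (auto simp: homology_cycles_def)

lemma homology_class_iff: "x \<in> homology_class K n z \<longleftrightarrow> x \<oplus>\<^sub>c z \<in> homology_boundaries K n"
proof
  assume "x \<in> homology_class K n z"
  then obtain b where "b \<in> homology_boundaries K n" "x = b \<oplus>\<^sub>c z"
    by (auto simp: homology_class_def)
  then show "x \<oplus>\<^sub>c z \<in> homology_boundaries K n" by (simp add: add.assoc)
next
  assume "x \<oplus>\<^sub>c z \<in> homology_boundaries K n"
  then show "x \<in> homology_class K n z"
    unfolding homology_class_def by (rule image_eqI[rotated]) (simp add: add.assoc)
qed

lemma homology_class_eq_iff:
  "homology_class K n z = homology_class K n w \<longleftrightarrow> z \<oplus>\<^sub>c w \<in> homology_boundaries K n"
proof
  assume "homology_class K n z = homology_class K n w"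
  moreover have "z \<in> homology_class K n z"
    by (simp add: homology_class_iff homology_boundaries_zero)
  ultimately show "z \<oplus>\<^sub>c w \<in> homology_boundaries K n" by (simp add: homology_class_iff)
next
  assume zw: "z \<oplus>\<^sub>c w \<in> homology_boundaries K n"
  have "x \<oplus>\<^sub>c z \<in> homology_boundaries K n \<longleftrightarrow> x \<oplus>\<^sub>c w \<in> homology_boundaries K n" for x
  proof -
    have "(x \<oplus>\<^sub>c z) \<oplus>\<^sub>c (z \<oplus>\<^sub>c w) = x \<oplus>\<^sub>c w" "(x \<oplus>\<^sub>c w) \<oplus>\<^sub>c (z \<oplus>\<^sub>c w) = x \<oplus>\<^sub>c z"
      by (auto simp: algebra_simps)
    then show ?thesis using homology_boundaries_add[OF _ zw] by metis
  qed
  then show "homology_class K n z = homology_class K n w" by (auto simp: homology_class_iff)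
qed

lemma simplicial_homology_carrier:
  "carrier (simplicial_homology K n) = homology_class K n ` homology_cycles K n"
  by (auto simp: simplicial_homology_def quotient_module_def A_RCOSETS_def RCOSETS_def r_coset_def
      chain_space_def homology_class_def)

lemma simplicial_homology_add:
  "homology_class K n z \<oplus>\<^bsub>simplicial_homology K n\<^esub> homology_class K n w =
    homology_class K n (z \<oplus>\<^sub>c w)"
proof -
  have "\<exists>x y. x \<oplus>\<^sub>c z \<in> homology_boundaries K n \<and> y \<oplus>\<^sub>c w \<in> homology_boundaries K n \<and> u = x \<oplus>\<^sub>c y"
    if u: "u \<oplus>\<^sub>c (z \<oplus>\<^sub>c w) \<in> homology_boundaries K n" for u
    by (rule exI[of _ "u \<oplus>\<^sub>c w"], rule exI[of _ w])
      (use u in \<open>simp add: homology_boundaries_zero algebra_simps\<close>)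
  moreover have "(x \<oplus>\<^sub>c y) \<oplus>\<^sub>c (z \<oplus>\<^sub>c w) \<in> homology_boundaries K n"
    if "x \<oplus>\<^sub>c z \<in> homology_boundaries K n" "y \<oplus>\<^sub>c w \<in> homology_boundaries K n" for x y
    using homology_boundaries_add[OF that] by (simp add: algebra_simps)
  ultimately have "{x \<oplus>\<^sub>c y |x y. x \<in> homology_class K n z \<and> y \<in> homology_class K n w} =
      homology_class K n (z \<oplus>\<^sub>c w)"
    unfolding homology_class_iff set_eq_iff mem_Collect_eq by blast
  moreover have "homology_class K n z \<oplus>\<^bsub>simplicial_homology K n\<^esub> homology_class K n w =
      {x \<oplus>\<^sub>c y |x y. x \<in> homology_class K n z \<and> y \<in> homology_class K n w}"
    by (auto simp: simplicial_homology_def quotient_module_def set_add_def set_mult_def chain_space_def)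
  ultimately show ?thesis by simp
qed

text \<open>The union that defines scalar multiplication runs over a nonempty family of equal
  cosets; as the scalar is 0 or 1, independence of the representative is a case split.\<close>

lemma simplicial_homology_smult:
  "a \<odot>\<^bsub>simplicial_homology K n\<^esub> homology_class K n z = homology_class K n (\<lambda>\<sigma>. a * z \<sigma>)"
proof -
  have "a \<odot>\<^bsub>simplicial_homology K n\<^esub> homology_class K n z =
      (\<Union>x\<in>homology_class K n z. homology_class K n (\<lambda>\<sigma>. a * x \<sigma>))"
    by (auto simp: simplicial_homology_def quotient_module_def a_r_coset_def r_coset_def
        chain_space_def homology_class_def)
  also have "\<dots> = homology_class K n (\<lambda>\<sigma>. a * z \<sigma>)"
  proof -
    have "homology_class K n (\<lambda>\<sigma>. a * x \<sigma>) = homology_class K n (\<lambda>\<sigma>. a * z \<sigma>)"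
      if "x \<in> homology_class K n z" for x
      using that unfolding homology_class_iff homology_class_eq_iff
      by (cases a) (auto simp: homology_boundaries_zero)
    moreover have "z \<in> homology_class K n z"
      by (simp add: homology_class_iff homology_boundaries_zero)
    ultimately show ?thesis by blast
  qed
  finally show ?thesis .
qed

section \<open>Betti numbers under inclusions of finite complexes\<close>

lemma finite_chain_space:
  assumes "finite K"
  shows "finite (carrier (chain_space K n))"
proof (rule finite_imageD)
  show "finite ((\<lambda>c. {\<sigma>. c \<sigma> \<noteq> 0}) ` carrier (chain_space K n))"
    by (rule finite_subset[of _ "Pow K"]) (use assms in \<open>auto simp: chain_space_iff simplices_def\<close>)
  have "c = d" if "{\<sigma>. c \<sigma> \<noteq> 0} = {\<sigma>. d \<sigma> \<noteq> 0}" for c d :: "'a set \<Rightarrow> bit"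
  proof
    show "c \<sigma> = d \<sigma>" for \<sigma>
      using that by (cases "c \<sigma>"; cases "d \<sigma>") (auto simp: set_eq_iff dest: spec[of _ \<sigma>])
  qed
  then show "inj_on (\<lambda>c. {\<sigma>. c \<sigma> \<noteq> 0}) (carrier (chain_space K n))" by (intro inj_onI)
qed

lemma finite_carrier_imp_fin_dim:
  assumes "vectorspace F W" "finite (carrier W)"
  shows "vectorspace.fin_dim F W"
proof -
  interpret vectorspace F W by fact
  have "span (carrier W) = carrier W"
    using in_own_span[of "carrier W"] span_is_subset2[of "carrier W"] by auto
  then show ?thesis using assms(2) unfolding fin_dim_def by blast
qed

text \<open>\<open>surj\<close> and \<open>inj\<close> say that the inclusion of \<open>L\<close>
  induces a bijective linear map on homology. Phrasing them by chains frees the later arguments from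
  quotients.\<close>

lemma betti_eqI:
  assumes "is_complex K" "is_complex L" "L \<subseteq> K" "finite K"
    and surj: "\<And>z. z \<in> homology_cycles K n \<Longrightarrow>
      \<exists>w\<in>homology_cycles L n. z \<oplus>\<^sub>c w \<in> homology_boundaries K n"
    and inj: "\<And>z. z \<in> homology_cycles L n \<Longrightarrow> z \<in> homology_boundaries K n \<Longrightarrow>
      z \<in> homology_boundaries L n"
  shows "betti L n = betti K n"
proof -
  let ?HL = "simplicial_homology L n" and ?HK = "simplicial_homology K n"
  \<comment> \<open>The induced map, written as a union over representatives to avoid choosing one:
    all these classes in \<open>K\<close> coincide.\<close>
  define f where "f A = (\<Union>x\<in>A. homology_class K n x)" for A
  have f: "f (homology_class L n z) = homology_class K n z" for z
  proof -
    have "homology_class K n x = homology_class K n z" if "x \<in> homology_class L n z" for x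
      using that homology_boundaries_mono[OF \<open>L \<subseteq> K\<close>, of n]
      unfolding homology_class_iff homology_class_eq_iff by blast
    moreover have "z \<in> homology_class L n z"
      by (simp add: homology_class_iff homology_boundaries_zero)
    ultimately show ?thesis unfolding f_def by blast
  qed
  note carrier = simplicial_homology_carrier
  have cyc: "homology_cycles L n \<subseteq> homology_cycles K n"
    by (rule homology_cycles_mono) fact
  have hom: "f \<in> module_hom Z2_field ?HL ?HK"
    unfolding module_hom_def
    using cyc by (auto simp: carrier simplicial_homology_add simplicial_homology_smult f)
  interpret linear_map Z2_field ?HL ?HK f
    by (intro linear_map.intro mod_hom.intro mod_hom_axioms.intro hom homology_vectorspace
        vectorspace.axioms(1)) fact+
  have "finite (homology_cycles L n)"
    by (rule finite_subset[OF _ finite_chain_space[OF finite_subset[OF \<open>L \<subseteq> K\<close> \<open>finite K\<close>]]])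
      (auto simp: homology_cycles_def)
  then have "V.fin_dim"
    using finite_carrier_imp_fin_dim[OF homology_vectorspace[OF \<open>is_complex L\<close>]]
    by (simp add: carrier)
  moreover have "inj_on f (carrier ?HL)"
  proof (rule inj_onI)
    fix x y assume "x \<in> carrier ?HL" "y \<in> carrier ?HL" "f x = f y"
    then obtain z w where "z \<in> homology_cycles L n" "w \<in> homology_cycles L n"
      "x = homology_class L n z" "y = homology_class L n w" "z \<oplus>\<^sub>c w \<in> homology_boundaries K n"
      unfolding carrier by (auto simp: f) (metis homology_class_eq_iff)
    then show "x = y" using inj[OF homology_cycles_add] by (simp add: homology_class_eq_iff)
  qed
  moreover have "f ` carrier ?HL = carrier ?HK"
  proof
    show "f ` carrier ?HL \<subseteq> carrier ?HK" using cyc by (auto simp: carrier f)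
    show "carrier ?HK \<subseteq> f ` carrier ?HL"
    proof
      fix x assume "x \<in> carrier ?HK"
      then obtain z w where "x = homology_class K n z" "w \<in> homology_cycles L n"
        "z \<oplus>\<^sub>c w \<in> homology_boundaries K n"
        unfolding carrier using surj by blast
      then show "x \<in> f ` carrier ?HL"
        by (auto simp: carrier f image_iff homology_class_eq_iff)
    qed
  qed
  ultimately show ?thesis unfolding betti_def by (rule dim_eq)
qed

section \<open>Even edge sets are sums of cycles\<close>

lemma handshake:
  assumes "finite E" "\<And>e. e \<in> E \<Longrightarrow> card e = 2"
  shows "(\<Sum>v\<in>\<Union>E. card {e \<in> E. v \<in> e}) = 2 * card E"
proof -
  have "finite e" if "e \<in> E" for e using assms(2)[OF that] by (metis card.infinite zero_neq_numeral)
  then have "finite (\<Union>E)" using assms(1) by auto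
  moreover have "card {v \<in> \<Union>E. v \<in> e} = 2" if "e \<in> E" for e
  proof -
    have "{v \<in> \<Union>E. v \<in> e} = e" using that by auto
    then show ?thesis using assms(2)[OF that] by simp
  qed
  ultimately show ?thesis using assms(1) by (subst sum_multicount[where k = 2]) auto
qed

text \<open>A nonempty set of edges that is smallest among those having at most as many vertices as
  edges is a cycle: dropping an edge, a leaf or a connected component would give a smaller one.\<close>

lemma exists_cycle_edges:
  assumes "finite E" "E \<noteq> {}" "\<And>e. e \<in> E \<Longrightarrow> card e = 2" "card (\<Union>E) \<le> card E"
  shows "\<exists>H\<subseteq>E. H \<noteq> {} \<and> (\<forall>v\<in>\<Union>H. card {e \<in> H. v \<in> e} = 2) \<and>
    graph_connected \<lparr>verts = \<Union>H, edges = H\<rparr>"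
proof -
  \<comment> \<open>A forest with an edge has fewer edges than vertices, so \<open>P\<close> forces
    a cycle inside \<open>H\<close>, and minimality leaves nothing else.\<close>
  define P where "P H \<longleftrightarrow> H \<subseteq> E \<and> H \<noteq> {} \<and> card (\<Union>H) \<le> card H" for H
  have "P E" using assms unfolding P_def by blast
  then obtain H where PH: "P H" and minimal: "\<And>H'. P H' \<Longrightarrow> card H \<le> card H'"
    using ex_has_least_nat[of P E card] by blast
  have H: "H \<subseteq> E" "H \<noteq> {}" "card (\<Union>H) \<le> card H" using PH by (auto simp: P_def)
  have card2: "card e = 2" if "e \<in> H" for e using that H(1) assms(3) by blast
  have finH: "finite H" using H(1) assms(1) finite_subset by blast
  have fine: "finite e" if "e \<in> H" for e
    using card2[OF that] by (metis card.infinite zero_neq_numeral)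
  have finU: "finite (\<Union>H)" using finH fine by auto
  have no_smaller: "card H' < card (\<Union>H')" if "H' \<subset> H" "H' \<noteq> {}" for H'
  proof (rule ccontr)
    assume "\<not> card H' < card (\<Union>H')"
    then have "P H'" using that H(1) by (auto simp: P_def)
    then show False using minimal psubset_card_mono[OF finH that(1)] by fastforce
  qed
  have two_edges: "H - {e} \<noteq> {}" if "e \<in> H" for e
  proof
    assume "H - {e} = {}"
    then have "H = {e}" using that by auto
    then show False using H(3) card2 by simp
  qed
  \<comment> \<open>Dropping the edge at a leaf lowers the number of edges by one and that of
    vertices by at least one, so \<open>P\<close> would persist.\<close>
  have degree_ge: "2 \<le> card {e \<in> H. v \<in> e}" if v: "v \<in> \<Union>H" for v
  proof (rule ccontr)
    assume "\<not> 2 \<le> card {e \<in> H. v \<in> e}"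
    moreover have "card {e \<in> H. v \<in> e} \<noteq> 0" using v finH by auto
    ultimately have "card {e \<in> H. v \<in> e} = 1" by linarith
    then obtain e where e: "{e \<in> H. v \<in> e} = {e}" by (auto simp: card_1_singleton_iff)
    then have eH: "e \<in> H" by blast
    have "\<Union>(H - {e}) \<subseteq> \<Union>H - {v}" using e by blast
    then have "card (\<Union>(H - {e})) \<le> card (\<Union>H) - 1"
      using card_mono[OF finite_Diff[OF finU]] v finU by (metis card_Diff_singleton)
    moreover have "card (H - {e}) = card H - 1" using eH finH by simp
    moreover have "card (H - {e}) < card (\<Union>(H - {e}))"
      using no_smaller[of "H - {e}"] two_edges[OF eH] eH by blast
    ultimately show False using H(3) by linarith
  qed
  \<comment> \<open>With strictly fewer vertices than edges, any edge could be dropped without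
    violating \<open>P\<close>.\<close>
  have card_eq: "card (\<Union>H) = card H"
  proof (rule ccontr)
    assume "card (\<Union>H) \<noteq> card H"
    obtain e where e: "e \<in> H" using H(2) by blast
    have "card (\<Union>(H - {e})) \<le> card (\<Union>H)" by (rule card_mono[OF finU]) blast
    moreover have "card (H - {e}) = card H - 1" using e finH by simp
    moreover have "card (H - {e}) < card (\<Union>(H - {e}))"
      using no_smaller[of "H - {e}"] two_edges[OF e] e by blast
    ultimately show False using H(3) \<open>card (\<Union>H) \<noteq> card H\<close> by linarith
  qed
  \<comment> \<open>The degrees sum to twice the number of edges, hence of vertices, and each is at
    least two, so none exceeds two.\<close>
  have degree: "card {e \<in> H. v \<in> e} = 2" if v: "v \<in> \<Union>H" for v
  proof (rule ccontr)
    assume "card {e \<in> H. v \<in> e} \<noteq> 2"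
    then have "(\<Sum>u\<in>\<Union>H. 2) < (\<Sum>u\<in>\<Union>H. card {e \<in> H. u \<in> e})"
      using degree_ge v finU
      by (intro sum_strict_mono_ex1) (auto simp: le_less intro!: bexI[of _ v])
    then show False using handshake[OF finH card2] card_eq by simp
  qed
  have "(adjacent \<lparr>verts = \<Union>H, edges = H\<rparr>)\<^sup>*\<^sup>* u v" if uv: "u \<in> \<Union>H" "v \<in> \<Union>H" for u v
  proof (rule ccontr)
    let ?adj = "adjacent \<lparr>verts = \<Union>H, edges = H\<rparr>"
    assume nr: "\<not> ?adj\<^sup>*\<^sup>* u v"
    \<comment> \<open>The component of \<open>u\<close> splits the edges into two nonempty parts
      with disjoint vertex sets. By minimality each part has fewer edges than vertices, which
      contradicts equality of the totals.\<close>
    define C where "C = {w. ?adj\<^sup>*\<^sup>* u w}"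
    define H1 where "H1 = {e \<in> H. e \<subseteq> C}"
    define H2 where "H2 = {e \<in> H. e \<inter> C = {}}"
    have "e \<subseteq> C \<or> e \<inter> C = {}" if e: "e \<in> H" for e
    proof -
      obtain a b where ab: "e = {a, b}" using card2[OF e] by (auto simp: card_2_iff)
      then have "?adj a b" "?adj b a" using e by (auto simp: adjacent_def insert_commute)
      then have "a \<in> C \<longleftrightarrow> b \<in> C" unfolding C_def by (auto intro: rtranclp.rtrancl_into_rtrancl)
      then show ?thesis using ab by auto
    qed
    then have split: "H = H1 \<union> H2" unfolding H1_def H2_def by blast
    have u: "u \<in> C" and v: "v \<notin> C" using nr by (auto simp: C_def)
    obtain eu ev where e: "eu \<in> H" "u \<in> eu" "ev \<in> H" "v \<in> ev" using uv by blast
    have "eu \<notin> H2" "ev \<notin> H1" using e u v by (auto simp: H1_def H2_def)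
    then have ne: "eu \<in> H1" "ev \<in> H2" using split e by auto
    have disj: "H1 \<inter> H2 = {}"
    proof (rule ccontr)
      assume "H1 \<inter> H2 \<noteq> {}"
      then have "{} \<in> H" by (auto simp: H1_def H2_def) (metis inf.absorb1)
      then show False using card2 by fastforce
    qed
    have disjU: "\<Union>H1 \<inter> \<Union>H2 = {}" unfolding H1_def H2_def by blast
    have "card H1 < card (\<Union>H1)" "card H2 < card (\<Union>H2)"
      using no_smaller[of H1] no_smaller[of H2] ne disj split by blast+
    moreover have "card H = card H1 + card H2"
      using split disj finH by (simp add: card_Un_disjoint)
    moreover have "card (\<Union>H) = card (\<Union>H1) + card (\<Union>H2)"
      using split disjU finU by (simp add: card_Un_disjoint)
    ultimately show False using card_eq by linarith
  qed
  then have "graph_connected \<lparr>verts = \<Union>H, edges = H\<rparr>" by (simp add: graph_connected_def)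
  then show ?thesis using H(1,2) degree by blast
qed

section \<open>Boundaries\<close>

text \<open>Removing different vertices gives different facets, so at most one summand is 1 and
  nothing cancels modulo 2.\<close>

lemma facet_sum:
  assumes "finite \<sigma>"
  shows "(\<Sum>x\<in>\<sigma>. if \<tau> = \<sigma> - {x} then 1 else 0 :: bit) = of_bool (\<exists>x\<in>\<sigma>. \<tau> = \<sigma> - {x})"
proof (cases "\<exists>x\<in>\<sigma>. \<tau> = \<sigma> - {x}")
  case True
  then obtain y where y: "y \<in> \<sigma>" "\<tau> = \<sigma> - {y}" by blast
  have "(\<Sum>x\<in>\<sigma>. if \<tau> = \<sigma> - {x} then 1 else 0 :: bit) = (\<Sum>x\<in>\<sigma>. if x = y then 1 else 0)"
    by (rule sum.cong) (use y in auto)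
  then show ?thesis using y assms by auto
next
  case False
  then show ?thesis by (simp add: sum.neutral)
qed

lemma boundary_eq_sum_facets:
  assumes "finite F" "{\<sigma>. c \<sigma> \<noteq> 0} \<subseteq> F" "n \<noteq> 0" "\<And>\<sigma>. \<sigma> \<in> F \<Longrightarrow> finite \<sigma>"
  shows "boundary n c \<tau> = (\<Sum>\<sigma>\<in>F. c \<sigma> * of_bool (\<exists>x\<in>\<sigma>. \<tau> = \<sigma> - {x}))"
  unfolding boundary_superset[OF assms(1-3)] by (rule sum.cong) (simp_all add: facet_sum assms(4))

definition indicator_chain :: "'a set set \<Rightarrow> 'a set \<Rightarrow> bit" where
  "indicator_chain S = (\<lambda>\<sigma>. of_bool (\<sigma> \<in> S))"

lemma indicator_chain_support [simp]: "{\<sigma>. indicator_chain S \<sigma> \<noteq> 0} = S"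
  by (auto simp: indicator_chain_def)

lemma chain_eq_indicator: "c = indicator_chain {\<sigma>. c \<sigma> \<noteq> 0}"
proof
  show "c \<sigma> = indicator_chain {\<sigma>. c \<sigma> \<noteq> 0} \<sigma>" for \<sigma>
    by (cases "c \<sigma>") (auto simp: indicator_chain_def)
qed

lemma indicator_chain_edge_sum:
  "indicator_chain (edge_sum A B) = indicator_chain A \<oplus>\<^sub>c indicator_chain B"
  by (auto simp: indicator_chain_def edge_sum_def)

lemma indicator_chain_Diff:
  assumes "H \<subseteq> E"
  shows "indicator_chain E \<oplus>\<^sub>c indicator_chain H = indicator_chain (E - H)"
proof -
  have "edge_sum E H = E - H" using assms by (auto simp: edge_sum_def)
  then show ?thesis using indicator_chain_edge_sum[of E H] by simp
qed

lemma boundary_indicator_singleton: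
  assumes "finite \<sigma>" "n \<noteq> 0"
  shows "boundary n (indicator_chain {\<sigma>}) = indicator_chain {\<sigma> - {x} |x. x \<in> \<sigma>}"
proof
  fix \<tau>
  have "boundary n (indicator_chain {\<sigma>}) \<tau> =
      (\<Sum>\<rho>\<in>{\<sigma>}. indicator_chain {\<sigma>} \<rho> * of_bool (\<exists>x\<in>\<rho>. \<tau> = \<rho> - {x}))"
    by (rule boundary_eq_sum_facets) (use assms in simp_all)
  also have "\<dots> = indicator_chain {\<sigma>} \<sigma> * of_bool (\<exists>x\<in>\<sigma>. \<tau> = \<sigma> - {x})"
    by (subst sum.insert) simp_all
  also have "\<dots> = indicator_chain {\<sigma> - {x} |x. x \<in> \<sigma>} \<tau>"
    unfolding indicator_chain_def mem_Collect_eq by (simp add: conj_commute Bex_def)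
  finally show "boundary n (indicator_chain {\<sigma>}) \<tau> = indicator_chain {\<sigma> - {x} |x. x \<in> \<sigma>} \<tau>" .
qed

lemma is_complex_finite: "is_complex K \<Longrightarrow> \<sigma> \<in> K \<Longrightarrow> finite \<sigma>"
  unfolding is_complex_def by blast

lemma is_complex_nonempty: "is_complex K \<Longrightarrow> \<sigma> \<in> K \<Longrightarrow> \<sigma> \<noteq> {}"
  unfolding is_complex_def by blast

lemma is_complex_face: "is_complex K \<Longrightarrow> \<sigma> \<in> K \<Longrightarrow> \<tau> \<subseteq> \<sigma> \<Longrightarrow> \<tau> \<noteq> {} \<Longrightarrow> \<tau> \<in> K"
  unfolding is_complex_def by blast

lemma chain_support:
  assumes "c \<in> carrier (chain_space K n)" "c \<sigma> \<noteq> 0"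
  shows "\<sigma> \<in> K" "card \<sigma> = n + 1" "finite \<sigma>"
proof -
  show "\<sigma> \<in> K" "card \<sigma> = n + 1" using assms by (auto simp: chain_space_iff simplices_def)
  then show "finite \<sigma>" by (metis card.infinite Suc_eq_plus1 nat.distinct(1))
qed

text \<open>\<open>boundary\<close> depends on its degree only through its being zero, so the
  dimension \<open>m\<close> of \<open>c\<close> may differ from \<open>n + 1\<close>. For
  \<open>m = n = 1\<close> this says that the augmentation of the boundary of a 1-chain
  vanishes.\<close>

lemma boundary_boundary_chain:
  assumes "c \<in> carrier (chain_space K m)"
  shows "boundary n (boundary (n + 1) c) = \<zero>\<^sub>c"
  by (rule boundary_boundary) (use chain_support[OF assms] assms in \<open>auto simp: chain_space_iff\<close>)

lemma homology_boundariesI: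
  "c \<in> carrier (chain_space K (n + 1)) \<Longrightarrow> boundary (n + 1) c \<in> homology_boundaries K n"
  by (simp add: homology_boundaries_def)

lemma homology_boundaries_subset_cycles:
  assumes "is_complex K"
  shows "homology_boundaries K n \<subseteq> homology_cycles K n"
proof
  fix b assume "b \<in> homology_boundaries K n"
  then obtain c where c: "c \<in> carrier (chain_space K (n + 1))" "b = boundary (n + 1) c"
    by (auto simp: homology_boundaries_def)
  show "b \<in> homology_cycles K n"
    unfolding homology_cycles_def c(2)
    using boundary_closed[OF assms c(1)] boundary_boundary_chain[OF c(1)] by blast
qed

lemma boundary_chain_sum:
  assumes "c \<in> carrier (chain_space K m)" "n \<noteq> 0"
  shows "boundary n c \<tau> = (\<Sum>\<sigma> | c \<sigma> \<noteq> 0. of_bool (\<exists>x\<in>\<sigma>. \<tau> = \<sigma> - {x}))"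
proof -
  have "boundary n c \<tau> = (\<Sum>\<sigma> | c \<sigma> \<noteq> 0. c \<sigma> * of_bool (\<exists>x\<in>\<sigma>. \<tau> = \<sigma> - {x}))"
    by (rule boundary_eq_sum_facets)
      (use assms chain_support[OF assms(1)] in \<open>auto simp: chain_space_iff\<close>)
  also have "\<dots> = (\<Sum>\<sigma> | c \<sigma> \<noteq> 0. of_bool (\<exists>x\<in>\<sigma>. \<tau> = \<sigma> - {x}))"
  proof (rule sum.cong[OF refl])
    show "c \<sigma> * of_bool (\<exists>x\<in>\<sigma>. \<tau> = \<sigma> - {x}) = of_bool (\<exists>x\<in>\<sigma>. \<tau> = \<sigma> - {x})"
      if "\<sigma> \<in> {\<sigma>. c \<sigma> \<noteq> 0}" for \<sigma>
      using that by (cases "c \<sigma>") simp_all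
  qed
  finally show ?thesis .
qed

section \<open>Cones\<close>

text \<open>Among the simplices containing \<open>a\<close>, only \<open>insert a \<tau>\<close> has
  \<open>\<tau>\<close> as a facet. A chain whose simplices all contain \<open>a\<close> is
  therefore determined by its boundary.\<close>

lemma boundary_of_coface_chain:
  assumes "c \<in> carrier (chain_space K m)" "n \<noteq> 0" "\<And>\<sigma>. c \<sigma> \<noteq> 0 \<Longrightarrow> a \<in> \<sigma>" "a \<notin> \<tau>"
  shows "boundary n c \<tau> = c (insert a \<tau>)"
proof -
  have "boundary n c \<tau> = (\<Sum>\<sigma> | c \<sigma> \<noteq> 0. c \<sigma> * of_bool (\<exists>x\<in>\<sigma>. \<tau> = \<sigma> - {x}))"
    by (rule boundary_eq_sum_facets)
      (use assms chain_support[OF assms(1)] in \<open>auto simp: chain_space_iff\<close>)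
  also have "\<dots> = (\<Sum>\<sigma> | c \<sigma> \<noteq> 0. if \<sigma> = insert a \<tau> then c \<sigma> else 0)"
  proof (rule sum.cong[OF refl])
    fix \<sigma> assume "\<sigma> \<in> {\<sigma>. c \<sigma> \<noteq> 0}"
    then have "a \<in> \<sigma>" using assms(3) by blast
    then have "(\<exists>x\<in>\<sigma>. \<tau> = \<sigma> - {x}) \<longleftrightarrow> \<sigma> = insert a \<tau>" using assms(4) by auto
    then show "c \<sigma> * of_bool (\<exists>x\<in>\<sigma>. \<tau> = \<sigma> - {x}) = (if \<sigma> = insert a \<tau> then c \<sigma> else 0)" by simp
  qed
  also have "\<dots> = c (insert a \<tau>)"
    using assms(1) by (simp add: chain_space_iff sum.delta)
  finally show ?thesis .
qed

text \<open>Adding the boundary of a cone with apex \<open>a\<close> leaves a cycle whose simplices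
  all contain \<open>a\<close>, and such a cycle is zero because its boundary determines it.\<close>

lemma cycle_in_cone_is_boundary:
  assumes K: "is_complex K" and z: "z \<in> homology_cycles K n" "n \<noteq> 0"
    and apex: "\<And>\<sigma>. z \<sigma> \<noteq> 0 \<Longrightarrow> insert a \<sigma> \<in> K"
  shows "z \<in> homology_boundaries K n"
proof -
  \<comment> \<open>Only simplices of \<open>z\<close> that avoid \<open>a\<close> are coned;
    joining \<open>a\<close> to one that contains it would not raise the dimension.\<close>
  define c where "c \<tau> = (if a \<in> \<tau> then z (\<tau> - {a}) else 0)" for \<tau>
  have zC: "z \<in> carrier (chain_space K n)" using z by (simp add: homology_cycles_def)
  have "\<tau> \<in> insert a ` {\<sigma>. z \<sigma> \<noteq> 0} \<and> \<tau> \<in> simplices K (n + 1)" if t: "c \<tau> \<noteq> 0" for \<tau>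
  proof -
    have a: "a \<in> \<tau>" "z (\<tau> - {a}) \<noteq> 0" using t by (auto simp: c_def split: if_splits)
    then have "\<tau> \<in> insert a ` {\<sigma>. z \<sigma> \<noteq> 0}" by (intro image_eqI[of _ _ "\<tau> - {a}"]) auto
    moreover have "\<tau> \<in> K" using apex[OF a(2)] a(1) by (simp add: insert_absorb)
    moreover have "card \<tau> = n + 2"
      using chain_support(2,3)[OF zC a(2)] a(1) by (metis Suc_eq_plus1 add_2_eq_Suc' card_Suc_Diff1 finite_Diff2 finite.emptyI finite.insertI)
    ultimately show ?thesis by (simp add: simplices_def)
  qed
  then have cC: "c \<in> carrier (chain_space K (n + 1))"
    unfolding chain_space_iff using chain_space_finite_support[OF zC]
    by (metis (mono_tags, lifting) finite_imageI finite_subset mem_Collect_eq subsetI)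
  define y where "y = z \<oplus>\<^sub>c boundary (n + 1) c"
  have yZ: "y \<in> homology_cycles K n"
    unfolding y_def using homology_boundaries_subset_cycles[OF K] cC
    by (intro homology_cycles_add z) (auto simp: homology_boundaries_def)
  then have yC: "y \<in> carrier (chain_space K n)" and y0: "boundary n y = \<zero>\<^sub>c"
    by (simp_all add: homology_cycles_def)
  have ay: "a \<in> \<tau>" if "y \<tau> \<noteq> 0" for \<tau>
  proof (rule ccontr)
    assume a: "a \<notin> \<tau>"
    have "boundary (n + 1) c \<tau> = c (insert a \<tau>)"
      by (rule boundary_of_coface_chain[OF cC]) (use a in \<open>auto simp: c_def split: if_splits\<close>)
    then have "y \<tau> = 0" using a by (simp add: y_def c_def)
    then show False using that by simp
  qed
  have "y \<tau> = 0" for \<tau>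
  proof (cases "a \<in> \<tau>")
    case True
    have "boundary n y (\<tau> - {a}) = y (insert a (\<tau> - {a}))"
      by (rule boundary_of_coface_chain[OF yC]) (use ay z in auto)
    then show ?thesis using True y0 by (simp add: insert_absorb)
  qed (use ay in blast)
  then have "z = boundary (n + 1) c"
    unfolding y_def by (metis (no_types, lifting) bit_add_self_left add.right_neutral ext)
  then show ?thesis using cC by (auto simp: homology_boundaries_def)
qed

section \<open>Flag complexes\<close>

text \<open>The case \<open>p = q\<close> is included, so that the singletons in
  \<open>\<sigma>\<close> must be simplices as well.\<close>

definition flag_complex :: "'a set set \<Rightarrow> bool" where
  "flag_complex K \<longleftrightarrow> is_complex K \<and>
    (\<forall>\<sigma>. finite \<sigma> \<and> \<sigma> \<noteq> {} \<and> (\<forall>p\<in>\<sigma>. \<forall>q\<in>\<sigma>. {p, q} \<in> K) \<longrightarrow> \<sigma> \<in> K)"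

lemma flag_complex_is_complex: "flag_complex K \<Longrightarrow> is_complex K"
  by (simp only: flag_complex_def)

lemma flag_complex_memI:
  assumes "flag_complex K" "finite \<sigma>" "\<sigma> \<noteq> {}" "\<And>p q. p \<in> \<sigma> \<Longrightarrow> q \<in> \<sigma> \<Longrightarrow> {p, q} \<in> K"
  shows "\<sigma> \<in> K"
  using assms unfolding flag_complex_def by blast

section \<open>First homology of flag complexes\<close>

text \<open>Flagness fills the triangle: its edges and vertices are simplices, hence so is the
  2-simplex that they bound.\<close>

lemma triangle_is_boundary:
  assumes K: "flag_complex K" and T: "T \<in> triangles (skeleton K)"
  shows "indicator_chain (edges T) \<in> homology_boundaries K 1"
proof -
  have TK: "edges T \<subseteq> K" "verts T \<subseteq> {v. {v} \<in> K}" and fin: "finite (verts T)"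
    and e: "\<And>e. e \<in> edges T \<Longrightarrow> e \<subseteq> verts T \<and> card e = 2"
    and deg: "\<And>v. v \<in> verts T \<Longrightarrow> card {e \<in> edges T. v \<in> e} = 2" and card3: "card (edges T) = 3"
    using T by (auto simp: triangles_def is_cycle_def is_subgraph_def simple_graph_def
        skeleton_def vertex_degree_def)
  have "v \<in> \<Union>(edges T)" if "v \<in> verts T" for v
  proof -
    have "{e \<in> edges T. v \<in> e} \<noteq> {}" using deg[OF that] by force
    then show ?thesis by blast
  qed
  then have U: "\<Union>(edges T) = verts T" using e by blast
  have "finite (edges T)" using card3 by (metis card.infinite zero_neq_numeral)
  \<comment> \<open>\<open>triangles\<close> prescribes degrees and the number of edges only;
    counting incidences yields three vertices.\<close>
  then have "2 * card (verts T) = 2 * 3"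
    using handshake[of "edges T"] e deg card3 by (simp add: U)
  then have "card (verts T) = 3" by simp
  then obtain a b c where abc: "verts T = {a, b, c}" "a \<noteq> b" "b \<noteq> c" "a \<noteq> c"
    by (auto simp: card_3_iff)
  have "edges T \<subseteq> {{a, b}, {b, c}, {a, c}}"
  proof
    fix f assume "f \<in> edges T"
    then have "f \<subseteq> {a, b, c}" "card f = 2" using e abc by auto
    then show "f \<in> {{a, b}, {b, c}, {a, c}}" using abc by (auto simp: card_2_iff doubleton_eq_iff)
  qed
  moreover have "card {{a, b}, {b, c}, {a, c}} = 3" using abc by (auto simp: doubleton_eq_iff card_insert_if)
  ultimately have ed: "edges T = {{a, b}, {b, c}, {a, c}}"
    using card3 by (intro card_subset_eq) auto
  have "{a, b, c} \<in> K"
  proof -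
    have "{a, b} \<in> K" "{b, c} \<in> K" "{a, c} \<in> K" "{a} \<in> K" "{b} \<in> K" "{c} \<in> K"
      using TK unfolding ed abc(1) by blast+
    then show ?thesis by (intro flag_complex_memI[OF K, of "{a, b, c}"]) (auto simp: insert_commute)
  qed
  then have "indicator_chain {{a, b, c}} \<in> carrier (chain_space K 2)"
    using abc by (simp add: chain_space_iff simplices_def)
  moreover have "boundary 2 (indicator_chain {{a, b, c}}) = indicator_chain (edges T)"
  proof -
    have "{{a, b, c} - {x} |x. x \<in> {a, b, c}} = edges T" unfolding ed using abc by auto
    then show ?thesis by (simp add: boundary_indicator_singleton)
  qed
  ultimately show ?thesis
    using homology_boundariesI[of "indicator_chain {{a, b, c}}" K 1] by (simp add: numeral_2_eq_2)
qed

lemma cycle_sum_is_boundary: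
  assumes "flag_complex K" "T \<subseteq> triangles (skeleton K)"
  shows "indicator_chain (cycle_sum T) \<in> homology_boundaries K 1"
  using assms(2)
proof (induction T rule: infinite_finite_induct)
  \<comment> \<open>On an infinite family the big operator has the default value \<open>{}\<close>,
    whose indicator is the zero chain.\<close>
  case (infinite T)
  have "cycle_sum T = {}"
    unfolding cycle_sum_def by (rule comm_monoid_set.infinite[OF comm_monoid_set_edge_sum infinite(1)])
  then show ?case using homology_boundaries_zero[of K 1] by (simp add: indicator_chain_def)
next
  case empty
  then show ?case using homology_boundaries_zero[of K 1]
    by (simp add: indicator_chain_def cycle_sum_empty)
next
  case (insert C T)
  then show ?case
    using homology_boundaries_add[OF triangle_is_boundary[OF assms(1)]]
    by (simp add: cycle_sum_insert indicator_chain_edge_sum)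
qed

text \<open>The coefficient of the boundary at \<open>{v}\<close> is the degree of \<open>v\<close>
  modulo 2.\<close>

lemma even_degree_of_cycle:
  assumes "z \<in> homology_cycles K 1"
  shows "even (card {\<sigma>. z \<sigma> \<noteq> 0 \<and> v \<in> \<sigma>})"
proof -
  have zC: "z \<in> carrier (chain_space K 1)" "boundary 1 z = \<zero>\<^sub>c"
    using assms by (auto simp: homology_cycles_def)
  have "0 = boundary 1 z {v}" using zC(2) by simp
  also have "\<dots> = (\<Sum>\<sigma> | z \<sigma> \<noteq> 0. of_bool (\<exists>x\<in>\<sigma>. {v} = \<sigma> - {x}))"
    by (rule boundary_chain_sum[OF zC(1)]) simp
  also have "\<dots> = (\<Sum>\<sigma> | z \<sigma> \<noteq> 0. of_bool (v \<in> \<sigma>))"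
  proof (rule sum.cong[OF refl])
    fix \<sigma> assume "\<sigma> \<in> {\<sigma>. z \<sigma> \<noteq> 0}"
    then have "card \<sigma> = 2" using chain_support(2)[OF zC(1)] by simp
    then obtain a b where "\<sigma> = {a, b}" "a \<noteq> b" by (auto simp: card_2_iff)
    then have "(\<exists>x\<in>\<sigma>. {v} = \<sigma> - {x}) \<longleftrightarrow> v \<in> \<sigma>" by auto
    then show "of_bool (\<exists>x\<in>\<sigma>. {v} = \<sigma> - {x}) = (of_bool (v \<in> \<sigma>) :: bit)" by simp
  qed
  also have "\<dots> = of_nat (card {\<sigma>. z \<sigma> \<noteq> 0 \<and> v \<in> \<sigma>})"
    using chain_space_finite_support[OF zC(1)] by (simp add: sum_of_bool_eq Int_def)
  finally show ?thesis by (metis even_of_nat_iff dvd_0_right)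
qed

text \<open>Induction on the size of the support: a nonzero cycle contains the edge set of a graph
  cycle, which is a sum of triangles and hence a boundary; adding it removes exactly these
  edges.\<close>

lemma flag_simple_connectedness_cycle_is_boundary:
  assumes K: "flag_complex K" "finite K" and sc: "simple_connectedness (skeleton K)"
    and z: "z \<in> homology_cycles K 1"
  shows "z \<in> homology_boundaries K 1"
  using z
proof (induction "card {\<sigma>. z \<sigma> \<noteq> 0}" arbitrary: z rule: less_induct)
  case less
  define E where "E = {\<sigma>. z \<sigma> \<noteq> 0}"
  have cK: "is_complex K" by (rule flag_complex_is_complex[OF K(1)])
  have zC: "z \<in> carrier (chain_space K 1)" using less.prems by (simp add: homology_cycles_def)
  have finE: "finite E" and EK: "E \<subseteq> K" and card2: "\<And>e. e \<in> E \<Longrightarrow> card e = 2"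
    using chain_space_finite_support[OF zC] chain_support[OF zC] by (auto simp: E_def)
  show ?case
  proof (cases "E = {}")
    case True
    then have "z = \<zero>\<^sub>c" by (auto simp: E_def)
    then show ?thesis using homology_boundaries_zero[of K 1] by simp
  next
    case False
    \<comment> \<open>Even degrees that are not zero are at least two, so double counting gives no
      more vertices than edges.\<close>
    have "2 \<le> card {e \<in> E. v \<in> e}" if "v \<in> \<Union>E" for v
    proof -
      have "card {e \<in> E. v \<in> e} \<noteq> 0" using that finE by auto
      moreover have "even (card {e \<in> E. v \<in> e})"
        using even_degree_of_cycle[OF less.prems] by (simp add: E_def)
      ultimately show ?thesis by (auto elim!: evenE)
    qed
    then have "(\<Sum>v\<in>\<Union>E. 2) \<le> (\<Sum>v\<in>\<Union>E. card {e \<in> E. v \<in> e})" by (intro sum_mono)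
    then have "card (\<Union>E) \<le> card E" using handshake[OF finE card2] by simp
    then obtain H where H: "H \<subseteq> E" "H \<noteq> {}" "\<forall>v\<in>\<Union>H. card {e \<in> H. v \<in> e} = 2"
      "graph_connected \<lparr>verts = \<Union>H, edges = H\<rparr>"
      using exists_cycle_edges[OF finE False card2] by blast
    have finH: "finite H" using H(1) finE finite_subset by blast
    have "finite e" if "e \<in> E" for e using EK that is_complex_finite[OF cK] by blast
    then have "finite (\<Union>H)" using finH H(1) by auto
    then have "simple_graph \<lparr>verts = \<Union>H, edges = H\<rparr>"
      using card2 H(1) by (auto simp: simple_graph_def)
    moreover have "{v} \<in> K" if "v \<in> \<Union>H" for v
      using that H(1) EK is_complex_face[OF cK, of _ "{v}"] by blast
    moreover have "\<Union>H \<noteq> {}" using H(1,2) card2 by fastforce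
    ultimately have "is_cycle (skeleton K) \<lparr>verts = \<Union>H, edges = H\<rparr>"
      using H card2 EK
      by (auto simp: is_cycle_def is_subgraph_def skeleton_def vertex_degree_def)
    \<comment> \<open>The cycle just found excludes the alternative of
      \<open>simple_connectedness\<close> that there is none.\<close>
    then obtain T where "T \<subseteq> triangles (skeleton K)" "H = cycle_sum T"
      using sc unfolding simple_connectedness_def by (metis graph.select_convs(2))
    then have HB: "indicator_chain H \<in> homology_boundaries K 1"
      using cycle_sum_is_boundary[OF K(1)] by blast
    have "z \<oplus>\<^sub>c indicator_chain H = indicator_chain (E - H)"
    proof -
      have "z = indicator_chain E" unfolding E_def by (rule chain_eq_indicator)
      then show ?thesis using indicator_chain_Diff[OF H(1)] by simp
    qed
    then have "{\<sigma>. (z \<oplus>\<^sub>c indicator_chain H) \<sigma> \<noteq> 0} = E - H" by (simp add: fun_eq_iff)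
    moreover have "card (E - H) < card E"
      using H finE by (intro psubset_card_mono) auto
    moreover have "z \<oplus>\<^sub>c indicator_chain H \<in> homology_cycles K 1"
      using homology_cycles_add[OF less.prems] HB homology_boundaries_subset_cycles[OF cK] by blast
    ultimately have "z \<oplus>\<^sub>c indicator_chain H \<in> homology_boundaries K 1"
      using less.hyps[of "z \<oplus>\<^sub>c indicator_chain H"] by (simp add: E_def)
    from homology_boundaries_add[OF this HB] show ?thesis by (simp add: add.assoc)
  qed
qed

text \<open>As \<^const>\<open>boundary\<close> has the same defining formula in all positive degrees,
  \<^term>\<open>boundary 1\<close> applied to a \<open>0\<close>-chain is its augmentation, carried by the empty simplex.\<close>

lemma connected_augmented_cycle_is_boundary:
  assumes K: "is_complex K" and con: "graph_connected (skeleton K)"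
    and z: "z \<in> carrier (chain_space K 0)" "boundary 1 z = \<zero>\<^sub>c"
  shows "z \<in> homology_boundaries K 0"
  using z
proof (induction "card {\<sigma>. z \<sigma> \<noteq> 0}" arbitrary: z rule: less_induct)
  case less
  \<comment> \<open>Induction along a walk: the sum of its edges has the two endpoints as
    boundary.\<close>
  have path: "indicator_chain {{u}} \<oplus>\<^sub>c indicator_chain {{v}} \<in> homology_boundaries K 0"
    if "(adjacent (skeleton K))\<^sup>*\<^sup>* u v" for u v
    using that
  proof induction
    case base
    show ?case using homology_boundaries_zero[of K 0] by simp
  next
    case (step v w)
    have vw: "{v, w} \<in> K" "v \<noteq> w" using step.hyps(2) by (auto simp: adjacent_def skeleton_def card_2_iff doubleton_eq_iff)
    have "indicator_chain {{v, w}} \<in> carrier (chain_space K 1)"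
      using vw by (simp add: chain_space_iff simplices_def)
    moreover have "boundary 1 (indicator_chain {{v, w}}) = indicator_chain {{v}} \<oplus>\<^sub>c indicator_chain {{w}}"
    proof -
      have "{{v, w} - {x} |x. x \<in> {v, w}} = edge_sum {{v}} {{w}}"
        using vw by (auto simp: edge_sum_def)
      then show ?thesis
        by (simp add: boundary_indicator_singleton indicator_chain_edge_sum[symmetric])
    qed
    ultimately have "indicator_chain {{v}} \<oplus>\<^sub>c indicator_chain {{w}} \<in> homology_boundaries K 0"
      using homology_boundariesI[of "indicator_chain {{v, w}}" K 0] by simp
    from homology_boundaries_add[OF step.IH this] show ?case by (simp add: add.assoc)
  qed
  define S where "S = {\<sigma>. z \<sigma> \<noteq> 0}"
  have finS: "finite S" unfolding S_def by (rule chain_space_finite_support[OF less.prems(1)])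
  \<comment> \<open>The value at the empty simplex counts the vertices of \<open>z\<close> modulo 2,
    so they can be cancelled in pairs.\<close>
  have "0 = boundary 1 z {}" using less.prems(2) by simp
  also have "\<dots> = (\<Sum>\<sigma>\<in>S. of_bool (\<exists>x\<in>\<sigma>. {} = \<sigma> - {x}))"
    unfolding S_def by (rule boundary_chain_sum[OF less.prems(1)]) simp
  also have "\<dots> = (\<Sum>\<sigma>\<in>S. 1)"
  proof (rule sum.cong[OF refl])
    fix \<sigma> assume "\<sigma> \<in> S"
    then have "card \<sigma> = 1" using chain_support(2)[OF less.prems(1)] by (simp add: S_def)
    then show "of_bool (\<exists>x\<in>\<sigma>. {} = \<sigma> - {x}) = (1 :: bit)" by (auto simp: card_1_singleton_iff)
  qed
  also have "\<dots> = of_nat (card S)" by simp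
  finally have even: "even (card S)" by (metis even_of_nat_iff dvd_0_right)
  show ?case
  proof (cases "S = {}")
    case True
    then have "z = \<zero>\<^sub>c" by (auto simp: S_def)
    then show ?thesis using homology_boundaries_zero[of K 0] by simp
  next
    case False
    then obtain \<sigma> where s: "\<sigma> \<in> S" by blast
    have "S \<noteq> {\<sigma>}" using even by auto
    then obtain \<tau> where t: "\<tau> \<in> S" "\<tau> \<noteq> \<sigma>" using s by blast
    have st: "\<sigma> \<in> K" "\<tau> \<in> K" "card \<sigma> = 1" "card \<tau> = 1"
      using s t(1) chain_support(1,2)[OF less.prems(1)] by (simp_all add: S_def)
    then obtain u v where uv: "\<sigma> = {u}" "\<tau> = {v}" by (meson card_1_singletonE)
    let ?c = "indicator_chain {\<sigma>} \<oplus>\<^sub>c indicator_chain {\<tau>}"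
    have cB: "?c \<in> homology_boundaries K 0"
      using con st uv path[of u v] by (simp add: graph_connected_def skeleton_def)
    have "?c \<in> homology_cycles K 0"
      using cB homology_boundaries_subset_cycles[OF K] by blast
    then have cC: "?c \<in> carrier (chain_space K 0)" by (simp add: homology_cycles_def)
    have c0: "boundary 1 ?c = \<zero>\<^sub>c"
    proof -
      obtain p where p: "p \<in> carrier (chain_space K 1)" "?c = boundary 1 p"
        using cB by (auto simp: homology_boundaries_def)
      \<comment> \<open>Reading the boundary of the 1-chain \<open>p\<close> in degree two makes the
        vanishing of the squared boundary applicable to the augmentation.\<close>
      have "boundary 1 p = boundary (1 + 1) p" by (simp add: boundary_def)
      then show ?thesis using boundary_boundary_chain[OF p(1), of 1] p(2) by simp
    qed
    have "z \<oplus>\<^sub>c ?c = indicator_chain (S - {\<sigma>, \<tau>})"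
    proof -
      have "z = indicator_chain S" unfolding S_def by (rule chain_eq_indicator)
      moreover have "edge_sum {\<sigma>} {\<tau>} = {\<sigma>, \<tau>}" using t(2) by (auto simp: edge_sum_def)
      then have "?c = indicator_chain {\<sigma>, \<tau>}" using indicator_chain_edge_sum[of "{\<sigma>}" "{\<tau>}"] by simp
      ultimately show ?thesis using indicator_chain_Diff[of "{\<sigma>, \<tau>}" S] s t(1)
        by (simp add: fun_eq_iff)
    qed
    then have "{\<rho>. (z \<oplus>\<^sub>c ?c) \<rho> \<noteq> 0} = S - {\<sigma>, \<tau>}" by (simp add: fun_eq_iff)
    moreover have "card (S - {\<sigma>, \<tau>}) < card S"
      using s finS by (intro psubset_card_mono) auto
    moreover have "boundary 1 (z \<oplus>\<^sub>c ?c) = \<zero>\<^sub>c"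
      using boundary_add_chain[OF less.prems(1) cC] less.prems(2) c0 by simp
    ultimately have "z \<oplus>\<^sub>c ?c \<in> homology_boundaries K 0"
      using less.hyps[of "z \<oplus>\<^sub>c ?c"] chain_space_add[OF less.prems(1) cC] by (simp add: S_def)
    from homology_boundaries_add[OF this cB] show ?thesis by (simp add: add.assoc)
  qed
qed

section \<open>Deleting a simplex\<close>

text \<open>The rim of \<open>\<sigma>\<close> is the intersection of the closed star of \<open>\<sigma>\<close> with the complex from
  which \<open>\<sigma>\<close> has been deleted.\<close>

definition rim :: "'a set \<Rightarrow> 'a set set \<Rightarrow> 'a set set" where
  "rim \<sigma> K = {\<tau> \<in> K. \<not> \<sigma> \<subseteq> \<tau> \<and> \<tau> \<union> \<sigma> \<in> K}"

lemma is_complex_rim: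
  assumes "is_complex K"
  shows "is_complex (rim \<sigma> K)"
  unfolding is_complex_def
proof (intro ballI conjI allI impI)
  fix \<tau> \<rho> assume t: "\<tau> \<in> rim \<sigma> K"
  then have tK: "\<tau> \<in> K" "\<not> \<sigma> \<subseteq> \<tau>" "\<tau> \<union> \<sigma> \<in> K" by (auto simp: rim_def)
  show "finite \<tau>" "\<tau> \<noteq> {}" using is_complex_finite[OF assms tK(1)] is_complex_nonempty[OF assms tK(1)] by auto
  assume r: "\<rho> \<subseteq> \<tau>" "\<rho> \<noteq> {}"
  have "\<rho> \<in> K" "\<rho> \<union> \<sigma> \<in> K"
    using is_complex_face[OF assms tK(1), of \<rho>] is_complex_face[OF assms tK(3), of "\<rho> \<union> \<sigma>"] r by auto
  then show "\<rho> \<in> rim \<sigma> K" using tK(2) r(1) by (auto simp: rim_def)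
qed

text \<open>The form \<open>{a, b}\<close> covers an edge and, with \<open>a = b\<close>, a vertex.
  If such a \<open>\<sigma>\<close> were contained in \<open>\<tau>\<close>, it would be one of the
  pairs of \<open>\<tau>\<close>, which the rim forbids.\<close>

lemma flag_complex_rim:
  assumes K: "flag_complex K" and s: "\<sigma> = {a, b}"
  shows "flag_complex (rim \<sigma> K)"
  unfolding flag_complex_def
proof (intro conjI allI impI)
  have cK: "is_complex K" by (rule flag_complex_is_complex[OF K])
  then show "is_complex (rim \<sigma> K)" by (rule is_complex_rim)
  fix \<tau> assume t: "finite \<tau> \<and> \<tau> \<noteq> {} \<and> (\<forall>p\<in>\<tau>. \<forall>q\<in>\<tau>. {p, q} \<in> rim \<sigma> K)"
  then have pq: "{p, q} \<in> K" "\<not> \<sigma> \<subseteq> {p, q}" "{p, q} \<union> \<sigma> \<in> K" if "p \<in> \<tau>" "q \<in> \<tau>" for p q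
    using that by (auto simp: rim_def)
  \<comment> \<open>Every pair in \<open>\<tau> \<union> \<sigma>\<close> lies in the union of
    \<open>\<sigma>\<close> with a pair of \<open>\<tau>\<close>, which is a simplex by
    assumption.\<close>
  have "{p, q} \<in> K" if mem: "p \<in> \<tau> \<union> \<sigma>" "q \<in> \<tau> \<union> \<sigma>" for p q
  proof -
    obtain r where r: "r \<in> \<tau>" using t by blast
    consider "p \<in> \<tau>" "q \<in> \<tau>" | "p \<in> \<tau>" "q \<in> \<sigma>" | "p \<in> \<sigma>" "q \<in> \<tau>" | "p \<in> \<sigma>" "q \<in> \<sigma>"
      using mem by blast
    then show ?thesis
    proof cases
      case 1 then show ?thesis by (rule pq)
    next
      case 2 then show ?thesis using is_complex_face[OF cK pq(3)[of p p], of "{p, q}"] by auto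
    next
      case 3 then show ?thesis using is_complex_face[OF cK pq(3)[of q q], of "{p, q}"] by auto
    next
      case 4 then show ?thesis using is_complex_face[OF cK pq(3)[of r r], of "{p, q}"] r by auto
    qed
  qed
  moreover have "finite (\<tau> \<union> \<sigma>)" "\<tau> \<union> \<sigma> \<noteq> {}" using t s by auto
  ultimately have "\<tau> \<union> \<sigma> \<in> K" by (blast intro: flag_complex_memI[OF K])
  moreover have "\<tau> \<in> K" by (rule flag_complex_memI[OF K]) (use t pq(1) in auto)
  moreover have "\<not> \<sigma> \<subseteq> \<tau>" using pq(2)[of a b] s by auto
  ultimately show "\<tau> \<in> rim \<sigma> K" by (simp add: rim_def)
qed

text \<open>The restriction to at most two vertices is essential: deleting a 2-simplex would leave
  an empty triangle.\<close>

lemma flag_complex_delete_simplex: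
  assumes "flag_complex K" "\<sigma> = {a, b}"
  shows "flag_complex (delete_simplex \<sigma> K)"
  unfolding flag_complex_def
proof (intro conjI allI impI)
  show "is_complex (delete_simplex \<sigma> K)"
    by (rule is_complex_delete_simplex[OF flag_complex_is_complex[OF assms(1)]])
  fix \<tau> assume t: "finite \<tau> \<and> \<tau> \<noteq> {} \<and> (\<forall>p\<in>\<tau>. \<forall>q\<in>\<tau>. {p, q} \<in> delete_simplex \<sigma> K)"
  then have "\<tau> \<in> K" by (intro flag_complex_memI[OF assms(1), of \<tau>]) (auto simp: delete_simplex_def)
  moreover have "\<not> \<sigma> \<subseteq> \<tau>"
  proof
    assume "\<sigma> \<subseteq> \<tau>"
    then have "{a, b} \<in> delete_simplex \<sigma> K" using t assms(2) by blast
    then show False using assms(2) by (simp add: delete_simplex_def)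
  qed
  ultimately show "\<tau> \<in> delete_simplex \<sigma> K" by (simp add: delete_simplex_def)
qed

lemma rim_subset: "rim \<sigma> K \<subseteq> delete_simplex \<sigma> K" "rim \<sigma> K \<subseteq> K"
  by (auto simp: rim_def delete_simplex_def)

section \<open>Cutting chains along the open star\<close>

text \<open>The restriction of \<open>c\<close> to the open star of \<open>\<sigma>\<close>. As
  \<open>1 + 1 = 0\<close>, adding it to \<open>c\<close> leaves the part outside the star.\<close>

definition star_part :: "'a set \<Rightarrow> ('a set \<Rightarrow> bit) \<Rightarrow> 'a set \<Rightarrow> bit" where
  "star_part \<sigma> c = (\<lambda>\<tau>. if \<sigma> \<subseteq> \<tau> then c \<tau> else 0)"

lemma star_part_chain:
  assumes "c \<in> carrier (chain_space K n)"
  shows "star_part \<sigma> c \<in> carrier (chain_space K n)"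
    and "c \<oplus>\<^sub>c star_part \<sigma> c \<in> carrier (chain_space (delete_simplex \<sigma> K) n)"
proof -
  have "{\<tau>. star_part \<sigma> c \<tau> \<noteq> 0} \<subseteq> {\<tau>. c \<tau> \<noteq> 0}" by (auto simp: star_part_def)
  then show "star_part \<sigma> c \<in> carrier (chain_space K n)"
    using assms unfolding chain_space_iff by (metis finite_subset order_trans)
  have "{\<tau>. c \<tau> + star_part \<sigma> c \<tau> \<noteq> 0} \<subseteq> {\<tau>. c \<tau> \<noteq> 0} \<inter> {\<tau>. \<not> \<sigma> \<subseteq> \<tau>}"
    by (auto simp: star_part_def)
  moreover have "{\<tau>. c \<tau> \<noteq> 0} \<inter> {\<tau>. \<not> \<sigma> \<subseteq> \<tau>} \<subseteq> simplices (delete_simplex \<sigma> K) n"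
    using chain_support[OF assms] by (auto simp: simplices_def delete_simplex_def)
  moreover have "finite ({\<tau>. c \<tau> \<noteq> 0} \<inter> {\<tau>. \<not> \<sigma> \<subseteq> \<tau>})"
    using chain_space_finite_support[OF assms] by blast
  ultimately show "c \<oplus>\<^sub>c star_part \<sigma> c \<in> carrier (chain_space (delete_simplex \<sigma> K) n)"
    unfolding chain_space_iff by (blast intro: finite_subset)
qed

text \<open>A face of a simplex containing \<open>\<sigma>\<close> lies together with
  \<open>\<sigma>\<close> in that simplex. If it does not contain \<open>\<sigma>\<close>, which the
  last assumption ensures, it belongs to the rim.\<close>

lemma boundary_star_part_in_rim:
  assumes K: "is_complex K" and c: "c \<in> carrier (chain_space K (n + 1))"
    and b: "boundary (n + 1) (star_part \<sigma> c) \<in> carrier (chain_space (delete_simplex \<sigma> K) n)"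
  shows "boundary (n + 1) (star_part \<sigma> c) \<in> carrier (chain_space (rim \<sigma> K) n)"
proof -
  let ?b = "boundary (n + 1) (star_part \<sigma> c)"
  have "\<tau> \<in> simplices (rim \<sigma> K) n" if t: "?b \<tau> \<noteq> 0" for \<tau>
  proof -
    obtain \<rho> where r: "star_part \<sigma> c \<rho> \<noteq> 0" "\<tau> \<subseteq> \<rho>"
      using boundary_support[of "n + 1" "star_part \<sigma> c"] t by blast
    then have "\<sigma> \<subseteq> \<rho>" "c \<rho> \<noteq> 0" by (auto simp: star_part_def split: if_splits)
    then have "\<rho> \<in> K" "\<tau> \<union> \<sigma> \<subseteq> \<rho>" using chain_support(1)[OF c] r by auto
    moreover have t': "\<tau> \<in> delete_simplex \<sigma> K" "card \<tau> = n + 1"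
      using chain_support[OF b t] by auto
    moreover have "\<tau> \<noteq> {}" using t'(2) by auto
    ultimately show ?thesis
      using is_complex_face[OF K, of \<rho> "\<tau> \<union> \<sigma>"]
      by (auto simp: simplices_def rim_def delete_simplex_def)
  qed
  then show ?thesis using b by (auto simp: chain_space_iff)
qed

text \<open>\<open>H0\<close> serves to push a cycle of \<open>K\<close> out of the open star,
  \<open>H1\<close> to push a filling out of it. \<open>H0\<close> concerns reduced homology, hence
  its condition on the augmentation.\<close>

lemma betti_1_delete_simplex:
  assumes K: "is_complex K" "finite K" and s: "\<sigma> \<in> K"
    and H0: "\<And>z. z \<in> carrier (chain_space (rim \<sigma> K) 0) \<Longrightarrow> boundary 1 z = \<zero>\<^sub>c \<Longrightarrow>
      z \<in> homology_boundaries (rim \<sigma> K) 0"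
    and H1: "\<And>z. z \<in> homology_cycles (rim \<sigma> K) 1 \<Longrightarrow> z \<in> homology_boundaries (rim \<sigma> K) 1"
  shows "betti (delete_simplex \<sigma> K) 1 = betti K 1"
proof (rule betti_eqI)
  let ?L = "delete_simplex \<sigma> K"
  show cL: "is_complex ?L" by (rule is_complex_delete_simplex[OF K(1)])
  show LK: "?L \<subseteq> K" by (auto simp: delete_simplex_def)
  show "is_complex K" "finite K" by fact+
  fix z
  show "\<exists>w\<in>homology_cycles ?L 1. z \<oplus>\<^sub>c w \<in> homology_boundaries K 1" if z: "z \<in> homology_cycles K 1"
  proof -
    have zC: "z \<in> carrier (chain_space K 1)" "boundary 1 z = \<zero>\<^sub>c"
      using z by (auto simp: homology_cycles_def)
    define y where "y = star_part \<sigma> z"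
    have yC: "y \<in> carrier (chain_space K 1)" and zyC: "z \<oplus>\<^sub>c y \<in> carrier (chain_space ?L 1)"
      unfolding y_def by (rule star_part_chain[OF zC(1)])+
    \<comment> \<open>As \<open>z\<close> is a cycle, its two pieces have the same boundary, which
      lies in the deleted complex and in the closed star, that is, in the rim.\<close>
    have zy: "boundary 1 (z \<oplus>\<^sub>c y) = boundary 1 y"
      using boundary_add_chain[OF zC(1) yC] zC(2) by simp
    have "boundary 1 y \<in> carrier (chain_space ?L 0)"
      using boundary_closed[OF cL, of _ 0] zyC zy by (simp; metis)
    then have "boundary 1 y \<in> carrier (chain_space (rim \<sigma> K) 0)"
      using boundary_star_part_in_rim[OF K(1), of z 0 \<sigma>] zC(1) by (simp add: y_def)
    moreover have "boundary 1 (boundary 1 y) = \<zero>\<^sub>c"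
    proof -
      have "boundary 1 y = boundary (1 + 1) y" by (simp add: boundary_def)
      then show ?thesis using boundary_boundary_chain[OF yC, of 1] by simp
    qed
    ultimately obtain p where p: "p \<in> carrier (chain_space (rim \<sigma> K) 1)" "boundary 1 y = boundary 1 p"
      using H0 by (auto simp: homology_boundaries_def)
    have pL: "p \<in> carrier (chain_space ?L 1)" and pK: "p \<in> carrier (chain_space K 1)"
      using p(1) chain_space_mono[OF rim_subset(1)] chain_space_mono[OF rim_subset(2)] by blast+
    have w: "(z \<oplus>\<^sub>c y) \<oplus>\<^sub>c p \<in> homology_cycles ?L 1"
      using chain_space_add[OF zyC pL] boundary_add_chain[OF zyC pL, of 1] zy p(2)
      by (simp add: homology_cycles_def)
    \<comment> \<open>Any vertex of \<open>\<sigma>\<close> is an apex of the closed star, where the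
      difference of the old and the new cycle lives.\<close>
    obtain a where a: "a \<in> \<sigma>" using is_complex_nonempty[OF K(1) s] by blast
    have "y \<oplus>\<^sub>c p \<in> homology_boundaries K 1"
    proof (rule cycle_in_cone_is_boundary[OF K(1)])
      show "y \<oplus>\<^sub>c p \<in> homology_cycles K 1"
        using chain_space_add[OF yC pK] boundary_add_chain[OF yC pK, of 1] p(2)
        by (simp add: homology_cycles_def)
      fix \<tau> assume "y \<tau> + p \<tau> \<noteq> 0"
      then consider "y \<tau> \<noteq> 0" | "p \<tau> \<noteq> 0" by fastforce
      then show "insert a \<tau> \<in> K"
      proof cases
        case 1
        then have "\<sigma> \<subseteq> \<tau>" "\<tau> \<in> K"
          using chain_support(1)[OF yC] by (auto simp: y_def star_part_def split: if_splits)
        then show ?thesis using a by (simp add: insert_absorb subsetD)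
      next
        case 2
        then have "\<tau> \<union> \<sigma> \<in> K" using chain_support(1)[OF p(1)] by (auto simp: rim_def)
        then show ?thesis by (rule is_complex_face[OF K(1)]) (use a in auto)
      qed
    qed simp
    moreover have "z \<oplus>\<^sub>c ((z \<oplus>\<^sub>c y) \<oplus>\<^sub>c p) = y \<oplus>\<^sub>c p" by (simp add: add.assoc)
    ultimately show ?thesis using w by metis
  qed
  show "z \<in> homology_boundaries ?L 1" if z: "z \<in> homology_cycles ?L 1" "z \<in> homology_boundaries K 1"
  proof -
    obtain c where c: "c \<in> carrier (chain_space K (1 + 1))" "z = boundary (1 + 1) c"
      using z(2) by (auto simp: homology_boundaries_def)
    define d where "d = star_part \<sigma> c"
    have dC: "d \<in> carrier (chain_space K (1 + 1))" and cdC: "c \<oplus>\<^sub>c d \<in> carrier (chain_space ?L (1 + 1))"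
      unfolding d_def by (rule star_part_chain[OF c(1)])+
    have cdB: "boundary (1 + 1) (c \<oplus>\<^sub>c d) \<in> homology_boundaries ?L 1"
      using cdC by (simp add: homology_boundaries_def)
    \<comment> \<open>The boundary of \<open>d\<close> differs from \<open>z\<close> by a boundary
      in the deleted complex, so it is a cycle there. It lies in the rim, where \<open>H1\<close>
      fills it without using the open star.\<close>
    have d: "boundary (1 + 1) d = z \<oplus>\<^sub>c boundary (1 + 1) (c \<oplus>\<^sub>c d)"
      using boundary_add_chain[OF c(1) dC, of "1 + 1"] c(2) by (auto simp: add.assoc)
    have "boundary (1 + 1) d \<in> homology_cycles ?L 1"
      unfolding d using homology_boundaries_subset_cycles[OF cL] cdB
      by (intro homology_cycles_add z(1)) blast
    then have "boundary (1 + 1) d \<in> homology_cycles (rim \<sigma> K) 1"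
      using boundary_star_part_in_rim[OF K(1) c(1)] by (simp add: homology_cycles_def d_def)
    then have "boundary (1 + 1) d \<in> homology_boundaries ?L 1"
      using H1 homology_boundaries_mono[OF rim_subset(1)] by blast
    from homology_boundaries_add[OF this cdB] show ?thesis
      unfolding d by (simp add: add.assoc)
  qed
qed

lemma betti_1_delete_simplex_flag:
  assumes K: "flag_complex K" "finite K" and s: "\<sigma> \<in> K" "\<sigma> = {a, b}"
    and del: "deletable_nbr_graph (skeleton (rim \<sigma> K))"
  shows "betti (delete_simplex \<sigma> K) 1 = betti K 1"
proof -
  have R: "flag_complex (rim \<sigma> K)" "finite (rim \<sigma> K)"
    using flag_complex_rim[OF K(1) s(2)] finite_subset[OF rim_subset(2) K(2)] by auto
  have "is_complex K" "is_complex (rim \<sigma> K)" using K(1) R(1) by (auto intro: flag_complex_is_complex)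
  then show ?thesis
    using del K(2) s(1) connected_augmented_cycle_is_boundary
      flag_simple_connectedness_cycle_is_boundary[OF R]
    unfolding deletable_nbr_graph_def by (intro betti_1_delete_simplex) auto
qed

section \<open>Neighbouring graphs as skeletons of rims\<close>

text \<open>Neighbours are given by edges alone; flagness converts containment in the neighbourhood
  of \<open>v\<close> into spanning a simplex with \<open>v\<close>.\<close>

lemma vertex_nbr_graph_eq_skeleton_rim:
  assumes K: "flag_complex K"
  shows "vertex_nbr_graph (skeleton K) v = skeleton (rim {v} K)"
proof -
  have cK: "is_complex K" by (rule flag_complex_is_complex[OF K])
  have single: "{p} \<in> K" "{q} \<in> K" if "{p, q} \<in> K" for p q
    using is_complex_face[OF cK that] by auto
  have nbr: "neighbours (skeleton K) v = {u. u \<noteq> v \<and> {u, v} \<in> K}"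
    by (auto simp: neighbours_def adjacent_def skeleton_def insert_commute card_insert_if)
  have cone: "e \<subseteq> neighbours (skeleton K) v \<longleftrightarrow> v \<notin> e \<and> e \<union> {v} \<in> K" if e: "e \<in> K" for e
  proof
    assume eN: "e \<subseteq> neighbours (skeleton K) v"
    have "e \<union> {v} \<in> K"
    proof (rule flag_complex_memI[OF K])
      show "finite (e \<union> {v})" using is_complex_finite[OF cK e] by simp
      \<comment> \<open>\<open>v\<close> is not assumed to be a vertex of \<open>K\<close>; having a
        neighbour makes it one.\<close>
      obtain r where r: "r \<in> e" using is_complex_nonempty[OF cK e] by blast
      fix p q assume "p \<in> e \<union> {v}" "q \<in> e \<union> {v}"
      moreover have "{v} \<in> K" using eN r single(2)[of r v] by (auto simp: nbr)
      ultimately show "{p, q} \<in> K"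
        using eN is_complex_face[OF cK e, of "{p, q}"] by (auto simp: nbr insert_commute subset_iff)
    qed simp
    then show "v \<notin> e \<and> e \<union> {v} \<in> K" using eN by (auto simp: nbr)
  next
    assume v: "v \<notin> e \<and> e \<union> {v} \<in> K"
    then have "{u, v} \<in> K" if "u \<in> e" for u
      using is_complex_face[OF cK, of "e \<union> {v}" "{u, v}"] that by blast
    then show "e \<subseteq> neighbours (skeleton K) v" using v by (auto simp: nbr)
  qed
  have "verts (vertex_nbr_graph (skeleton K) v) = {w. {w} \<in> K \<and> w \<in> neighbours (skeleton K) v}"
    by (auto simp: vertex_nbr_graph_def induced_def skeleton_def)
  moreover have "verts (skeleton (rim {v} K)) = {w. {w} \<in> K \<and> v \<notin> {w} \<and> {w} \<union> {v} \<in> K}"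
    by (auto simp: skeleton_def rim_def)
  moreover have "w \<in> neighbours (skeleton K) v \<longleftrightarrow> v \<notin> {w} \<and> {w} \<union> {v} \<in> K" if "{w} \<in> K" for w
    using cone[OF that] by simp
  ultimately have verts: "verts (vertex_nbr_graph (skeleton K) v) = verts (skeleton (rim {v} K))"
    by blast
  have "edges (vertex_nbr_graph (skeleton K) v) =
      {e \<in> K. card e = 2 \<and> e \<subseteq> neighbours (skeleton K) v}"
    by (auto simp: vertex_nbr_graph_def induced_def skeleton_def)
  moreover have "edges (skeleton (rim {v} K)) = {e \<in> K. card e = 2 \<and> v \<notin> e \<and> e \<union> {v} \<in> K}"
    by (auto simp: skeleton_def rim_def)
  ultimately have edges: "edges (vertex_nbr_graph (skeleton K) v) = edges (skeleton (rim {v} K))"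
    using cone by blast
  show ?thesis
    by (rule graph.equality[OF verts edges]) (simp add: vertex_nbr_graph_def induced_def skeleton_def)
qed

lemma edge_nbr_graph_eq_skeleton_rim:
  assumes K: "flag_complex K" and uv: "{u, v} \<in> K" "u \<noteq> v"
  shows "edge_nbr_graph (skeleton K) u v = skeleton (rim {u, v} K)"
proof -
  have cK: "is_complex K" by (rule flag_complex_is_complex[OF K])
  have single: "{p} \<in> K" "{q} \<in> K" if "{p, q} \<in> K" for p q
    using is_complex_face[OF cK that] by auto
  define W where "W = neighbours (skeleton K) u \<inter> neighbours (skeleton K) v \<union> {u, v}"
  \<comment> \<open>\<open>u\<close> and \<open>v\<close> fit the same description because
    \<open>{u, u}\<close> is a singleton; they are the two suspension points of the rim.\<close>
  have W: "w \<in> W \<longleftrightarrow> {w, u} \<in> K \<and> {w, v} \<in> K" for w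
    using single uv by (auto simp: W_def neighbours_def adjacent_def skeleton_def insert_commute card_insert_if)
  have cone: "e \<subseteq> W \<longleftrightarrow> e \<union> {u, v} \<in> K" if e: "e \<in> K" for e
  proof
    assume eW: "e \<subseteq> W"
    show "e \<union> {u, v} \<in> K"
    proof (rule flag_complex_memI[OF K])
      show "finite (e \<union> {u, v})" using is_complex_finite[OF cK e] by simp
      fix p q assume "p \<in> e \<union> {u, v}" "q \<in> e \<union> {u, v}"
      then show "{p, q} \<in> K"
        using eW W uv single is_complex_face[OF cK e, of "{p, q}"] by (auto simp: insert_commute subset_iff)
    qed simp
  next
    assume "e \<union> {u, v} \<in> K"
    then show "e \<subseteq> W"
      using is_complex_face[OF cK, of "e \<union> {u, v}"] by (auto simp: W)
  qed
  have "verts (edge_nbr_graph (skeleton K) u v) = {w. {w} \<in> K \<and> w \<in> W}"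
    by (auto simp: edge_nbr_graph_def Let_def induced_def W_def skeleton_def)
  moreover have "verts (skeleton (rim {u, v} K)) = {w. {w} \<in> K \<and> {w} \<union> {u, v} \<in> K}"
    using uv(2) by (auto simp: skeleton_def rim_def)
  moreover have "w \<in> W \<longleftrightarrow> {w} \<union> {u, v} \<in> K" if "{w} \<in> K" for w
    using cone[OF that] by simp
  ultimately have verts: "verts (edge_nbr_graph (skeleton K) u v) = verts (skeleton (rim {u, v} K))"
    by blast
  have edges1: "edges (edge_nbr_graph (skeleton K) u v) = {e \<in> K. card e = 2 \<and> e \<subseteq> W \<and> e \<noteq> {u, v}}"
    by (auto simp: edge_nbr_graph_def Let_def induced_def W_def skeleton_def)
  have edges2: "edges (skeleton (rim {u, v} K)) =
      {e \<in> K. card e = 2 \<and> e \<union> {u, v} \<in> K \<and> \<not> {u, v} \<subseteq> e}"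
    by (auto simp: skeleton_def rim_def)
  \<comment> \<open>Among sets of two elements, \<open>{u, v}\<close> is the only one containing
    \<open>{u, v}\<close>, so removing one edge from the graph matches the removal of the whole open
    star.\<close>
  have contains: "e \<noteq> {u, v} \<longleftrightarrow> \<not> {u, v} \<subseteq> e" if "card e = 2" for e
    using that uv(2) by (auto simp: card_2_iff)
  have edges: "edges (edge_nbr_graph (skeleton K) u v) = edges (skeleton (rim {u, v} K))"
    unfolding edges1 edges2 by (intro Collect_cong conj_cong refl cone contains)
  show ?thesis
    by (rule graph.equality[OF verts edges]) (simp add: edge_nbr_graph_def Let_def induced_def skeleton_def)
qed

section \<open>HP transformations\<close>

text \<open>Flagness is carried along because the identification of neighbouring graphs with rims
  relies on it at every step.\<close>

lemma hp_step_betti_1: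
  assumes step: "hp_step K L" and K: "flag_complex K" "finite K"
  shows "betti L 1 = betti K 1" "flag_complex L" "finite L"
proof -
  obtain \<sigma> a b where s: "\<sigma> \<in> K" "\<sigma> = {a, b}" "L = delete_simplex \<sigma> K"
    "deletable_nbr_graph (skeleton (rim \<sigma> K))"
    using step
  proof cases
    case (delete_vertex v)
    then show ?thesis
      using that[of "{v}" v v] vertex_nbr_graph_eq_skeleton_rim[OF K(1)] by (simp add: skeleton_def)
  next
    case (delete_edge u v)
    then have "{u, v} \<in> K" "u \<noteq> v" by (auto simp: skeleton_def)
    then show ?thesis
      using that[of "{u, v}" u v] edge_nbr_graph_eq_skeleton_rim[OF K(1)] delete_edge by simp
  qed
  show "betti L 1 = betti K 1"
    unfolding s(3) by (rule betti_1_delete_simplex_flag[OF K s(1,2,4)])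
  show "flag_complex L" unfolding s(3) by (rule flag_complex_delete_simplex[OF K(1) s(2)])
  show "finite L" using K(2) by (simp add: s(3) delete_simplex_def)
qed

lemma hp_transformation_betti_1:
  assumes "hp_transformation K L" "flag_complex K" "finite K"
  shows "betti L 1 = betti K 1"
proof -
  have "hp_step\<^sup>*\<^sup>* K L" using assms(1) by (simp add: hp_transformation_def)
  then have "betti L 1 = betti K 1 \<and> flag_complex L \<and> finite L"
    by induction (use assms hp_step_betti_1 in auto)
  then show ?thesis by blast
qed

lemma flag_complex_rips:
  assumes "R \<ge> 0"
  shows "flag_complex (rips V R)"
  unfolding flag_complex_def
proof (intro conjI allI impI is_complex_rips)
  fix \<sigma> assume s: "finite \<sigma> \<and> \<sigma> \<noteq> {} \<and> (\<forall>p\<in>\<sigma>. \<forall>q\<in>\<sigma>. {p, q} \<in> rips V R)"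
  have "p \<in> V" "dist p q \<le> R" if "p \<in> \<sigma>" "q \<in> \<sigma>" for p q
  proof -
    have "{p, q} \<in> rips V R" using s that by blast
    \<comment> \<open>The pairwise condition is silent for \<open>p = q\<close>; there the bound
      reads \<open>0 \<le> R\<close>.\<close>
    then show "p \<in> V" "dist p q \<le> R"
      using assms by (cases "p = q"; auto simp: rips_def pairwise_def)+
  qed
  then show "\<sigma> \<in> rips V R" using s by (auto simp: rips_def pairwise_def)
qed

theorem theorem4:
  fixes V :: "(real ^ 2) set" and R\<^sub>c :: real and K :: "(real ^ 2) set set"
  assumes "finite V"
    and "R\<^sub>c > 0"
    and "graph_connected (skeleton (rips V R\<^sub>c))"
    and "hp_transformation (rips V R\<^sub>c) K"
  shows "number_of_holes K = number_of_holes (rips V R\<^sub>c)"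
proof -
  have "finite (rips V R\<^sub>c)"
    by (rule finite_subset[of _ "Pow V"]) (use assms(1) in \<open>auto simp: rips_def\<close>)
  moreover have "flag_complex (rips V R\<^sub>c)" using assms(2) by (intro flag_complex_rips) simp
  ultimately show ?thesis
    unfolding number_of_holes_def using hp_transformation_betti_1 assms(4) by blast
qed

end
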